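(* Fix a constant $\epsilon>0$ not depending on $n$. Let $q=q_n$, $\ell=\ell_n$ be integers with $1 \le q < q+\ell \le n$ and $q^2 \ge \ell n^{1+\epsilon}$. Then for any $D = D_n = o\big((\log n/\log\log n)^2\big)$, no sequence of polynomials of degree at most $D$ weakly separates $\mathbb{P}=\mathrm{MC}(n,q)$ and $\mathbb{Q}=\mathrm{MC}(n,q+\ell)$.
   Context: Graphs on vertex set $[n]$ are encoded as $Y \in \{\pm 1\}^{\binom{n}{2}}$, with $Y_{ij}=+1$ if edge $\{i,j\}$ is present and $-1$ otherwise; polynomials are in these $\binom n2$ variables. The model $\mathrm{MC}(n,q)$: each vertex independently receives a uniformly random label in $[q]$; vertices with the same label are always connected, and vertices with different labels are connected independently with probability $1/2$. A polynomial $f=f_n$ weakly separates $\mathbb{P}$ and $\mathbb{Q}$ if $\sqrt{\max\{\mathrm{Var}_{\mathbb{Q}}[f],\mathrm{Var}_{\mathbb{P}}[f]\}} = O(|\mathbb{E}_{\mathbb{P}}[f]-\mathbb{E}_{\mathbb{Q}}[f]|)$ as $n\to\infty$.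
   Formalization: Weak separation here also requires the two expectations of f to differ for all large n; without this, constant polynomials (zero variance, zero mean gap, 0 = O(0)) would weakly separate any two models and the claim would be false. *)

theory Defs
  imports
    "HOL-Probability.Probability"
    "HOL-Library.Poly_Mapping"
    "HOL-Library.Landau_Symbols"
begin

section \<open>Graphs and the multi-community model\<close>

text \<open>The unordered pair \<open>{i, j}\<close> of vertices in \<open>{1..n}\<close> is represented by the
  ordered pair with \<open>i < j\<close>.\<close>

definition edges :: "nat \<Rightarrow> (nat \<times> nat) set" where
  "edges n = {(i, j). 1 \<le> i \<and> i < j \<and> j \<le> n}"

text \<open>A graph on \<open>{1..n}\<close> is a function with values \<open>1\<close> and \<open>-1\<close> on \<^term>\<open>edges n\<close>. The value
  at all other pairs is set to the dummy \<open>0\<close>; polynomials in the variables \<^term>\<open>edges n\<close> never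
  look at it.\<close>

type_synonym graph = "nat \<times> nat \<Rightarrow> real"

definition community_labels :: "nat \<Rightarrow> nat \<Rightarrow> (nat \<Rightarrow> nat) pmf" where
  "community_labels n q = Pi_pmf {1..n} 0 (\<lambda>_. pmf_of_set {1..q})"

definition MC_given_labels :: "nat \<Rightarrow> (nat \<Rightarrow> nat) \<Rightarrow> graph pmf" where
  "MC_given_labels n \<sigma> =
     Pi_pmf (edges n) 0
       (\<lambda>(i, j). if \<sigma> i = \<sigma> j then return_pmf 1 else pmf_of_set {1, -1})"

text \<open>Only meaningful for \<open>q \<ge> 1\<close>, since \<^const>\<open>pmf_of_set\<close> is unspecified on the empty set.\<close>

definition MC :: "nat \<Rightarrow> nat \<Rightarrow> graph pmf" where
  "MC n q = bind_pmf (community_labels n q) (MC_given_labels n)"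


section \<open>Multivariate polynomials\<close>

text \<open>Polynomials are finitely supported maps from monomials to coefficients, where a monomial
  is a finitely supported map from variables to exponents.\<close>

type_synonym 'v monomial = "'v \<Rightarrow>\<^sub>0 nat"
type_synonym 'v real_poly = "'v monomial \<Rightarrow>\<^sub>0 real"

definition monomial_degree :: "'v monomial \<Rightarrow> nat" where
  "monomial_degree m = (\<Sum>v\<in>Poly_Mapping.keys m. Poly_Mapping.lookup m v)"

definition poly_vars :: "'v real_poly \<Rightarrow> 'v set" where
  "poly_vars p = (\<Union>m\<in>Poly_Mapping.keys p. Poly_Mapping.keys m)"

text \<open>The zero polynomial is given total degree \<open>0\<close>.\<close>

definition total_degree :: "'v real_poly \<Rightarrow> nat" where
  "total_degree p = Max (insert 0 (monomial_degree ` Poly_Mapping.keys p))"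

definition poly_eval :: "'v real_poly \<Rightarrow> ('v \<Rightarrow> real) \<Rightarrow> real" where
  "poly_eval p Y = (\<Sum>m\<in>Poly_Mapping.keys p. Poly_Mapping.lookup p m * (\<Prod>v\<in>Poly_Mapping.keys m. Y v ^ Poly_Mapping.lookup m v))"


section \<open>Weak separation\<close>

text \<open>The first conjunct spells out the convention implicit in bounding the fluctuations by the
  mean gap: the gap is nonzero for all large \<open>n\<close>. Without it every sequence of constants would
  weakly separate any two sequences of distributions, as \<open>0 = O(0)\<close>.\<close>

definition weakly_separates ::
  "(nat \<Rightarrow> 'a \<Rightarrow> real) \<Rightarrow> (nat \<Rightarrow> 'a pmf) \<Rightarrow> (nat \<Rightarrow> 'a pmf) \<Rightarrow> bool" where
  "weakly_separates f P Q \<longleftrightarrow>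
     (\<forall>\<^sub>F n in sequentially.
        measure_pmf.expectation (P n) (f n) \<noteq> measure_pmf.expectation (Q n) (f n)) \<and>
     (\<lambda>n. sqrt (max (measure_pmf.variance (Q n) (f n)) (measure_pmf.variance (P n) (f n))))
       \<in> O[sequentially](\<lambda>n. \<bar>measure_pmf.expectation (P n) (f n)
                             - measure_pmf.expectation (Q n) (f n)\<bar>)"

end

theory Submission
  imports Defs "HOL-Real_Asymp.Real_Asymp"
begin

text \<open>
  Write \<open>P = MC(n, q)\<close>, \<open>Q = MC(n, q + l)\<close>, let \<open>f = \<Sum> c\<^sub>S Y\<^sup>S\<close> have degree at most \<open>N\<close>, and let
  \<open>M\<^sub>T\<^sub>S\<close> be the probability under \<open>Q\<close> that the edges of \<open>S\<close> joining different communities are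
  exactly those of \<open>T\<close>. Conditionally on the labels, Parseval's identity computes the second moment
  of \<open>f\<close>; averaging over the labels inside the squares (Jensen) gives
  \<open>Var\<^sub>Q f \<ge> \<Sum>\<^sub>T (\<Sum>\<^sub>S c\<^sub>S M\<^sub>T\<^sub>S)\<^sup>2\<close>, summed over nonempty \<open>T\<close>. As \<open>M\<close> is triangular, the system
  \<open>\<Sum>\<^sub>T w\<^sub>T M\<^sub>T\<^sub>S = E\<^sub>P Y\<^sup>S\<close> has a solution \<open>w\<close>, and by Cauchy-Schwarz the squared mean gap is at most
  \<open>\<Sum>\<^sub>T w\<^sub>T\<^sup>2 Var\<^sub>Q f\<close>.

  The solution \<open>w\<close> is multiplicative over vertex-disjoint unions. For connected \<open>S\<close> with \<open>v\<close>
  vertices, \<open>E\<^sub>P Y\<^sup>S - E\<^sub>Q Y\<^sup>S\<close> has order \<open>l / q\<^sup>v\<close>, and the recursion yields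
  \<open>|w\<^sub>S| \<le> (8 N)\<^sup>e \<rho>\<^sup>v\<close> with \<open>e\<close> the number of edges and \<open>\<rho>\<^sup>2 \<ge> l / q\<^sup>2\<close>; here
  \<open>\<rho>\<^sup>2 = n powr -(1 + \<epsilon>)\<close> is allowed. A graph with \<open>e \<le> N\<close> edges has \<open>e \<le> v \<surd>N\<close>, so factors of
  order \<open>N\<close> per edge, including the number of graphs on a given vertex set, cost only
  \<open>exp (O(\<surd>N ln N))\<close> per vertex. This is \<open>n\<close> to the power \<open>o(1)\<close> precisely in the stated degree
  range, so the sum over all graphs tends to \<open>0\<close>.
\<close>

section \<open>Crossing patterns of a random labelling\<close>

definition verts :: "('v \<times> 'v) set \<Rightarrow> 'v set" where
  "verts S = fst ` S \<union> snd ` S"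

definition crossing :: "('v \<Rightarrow> 'c) \<Rightarrow> ('v \<times> 'v) set" where
  "crossing \<sigma> = {(i, j). \<sigma> i \<noteq> \<sigma> j}"

text \<open>Connectivity is encoded as indecomposability into vertex-disjoint parts, the form that
  matches the factorisation lemmas. The empty set counts as connected.\<close>

definition edge_connected :: "('v \<times> 'v) set \<Rightarrow> bool" where
  "edge_connected S \<longleftrightarrow>
     (\<forall>S1 S2. S = S1 \<union> S2 \<longrightarrow> verts S1 \<inter> verts S2 = {} \<longrightarrow> S1 = {} \<or> S2 = {})"

text \<open>The default 0 off the vertex set matches \<open>community_labels\<close>, so
  probabilities of label events are counts divided by \<open>q ^ n\<close>.\<close>

definition labelings :: "nat \<Rightarrow> nat \<Rightarrow> (nat \<Rightarrow> nat) set" where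
  "labelings n q = PiE_dflt {1..n} 0 (\<lambda>_. {1..q})"

text \<open>This is the matrix M of the overview, with the row index \<open>T\<close> as second
  argument; for \<open>T = {}\<close> it is the mean of the character of \<open>S\<close>.\<close>

definition cross_freq :: "nat \<Rightarrow> nat \<Rightarrow> (nat \<times> nat) set \<Rightarrow> (nat \<times> nat) set \<Rightarrow> real" where
  "cross_freq n q S T = real (card {\<sigma> \<in> labelings n q. S \<inter> crossing \<sigma> = T}) / real q ^ n"

section \<open>Vertex sets of edge sets\<close>

lemma vertsI: "(i, j) \<in> S \<Longrightarrow> i \<in> verts S" "(i, j) \<in> S \<Longrightarrow> j \<in> verts S"
  by (force simp: verts_def)+

lemma verts_empty [simp]: "verts {} = {}"
  by (simp add: verts_def)

lemma verts_Un: "verts (S \<union> T) = verts S \<union> verts T"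
  by (auto simp: verts_def)

lemma verts_mono: "S \<subseteq> T \<Longrightarrow> verts S \<subseteq> verts T"
  by (auto simp: verts_def)

lemma verts_eq_empty_iff [simp]: "verts S = {} \<longleftrightarrow> S = {}"
  by (auto simp: verts_def)

lemma finite_verts: "finite S \<Longrightarrow> finite (verts S)"
  by (simp add: verts_def)

lemma card_verts_le: "finite S \<Longrightarrow> card (verts S) \<le> 2 * card S"
  using card_Un_le[of "fst ` S" "snd ` S"] card_image_le[of S fst] card_image_le[of S snd]
  by (auto simp: verts_def)

lemma verts_edges: "S \<subseteq> edges n \<Longrightarrow> verts S \<subseteq> {1..n}"
  by (fastforce simp: verts_def edges_def)

lemma finite_edges [simp]: "finite (edges n)"
  by (rule finite_subset[of _ "{1..n} \<times> {1..n}"]) (auto simp: edges_def)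

lemma card_verts_ge_2:
  assumes "S \<subseteq> edges n" "S \<noteq> {}"
  shows "2 \<le> card (verts S)"
proof -
  obtain i j where ij: "(i, j) \<in> S" "i \<noteq> j"
    using assms by (fastforce simp: edges_def)
  have "card {i, j} \<le> card (verts S)"
    using ij finite_subset[OF assms(1)] by (intro card_mono finite_verts) (force simp: verts_def)+
  then show ?thesis using ij by simp
qed

lemma disjoint_verts_imp_disjoint: "verts S \<inter> verts T = {} \<Longrightarrow> S \<inter> T = {}"
  by (force simp: verts_def)

section \<open>Counting labellings by their crossing pattern\<close>

lemma finite_labelings [simp]: "finite (labelings n q)"
  unfolding labelings_def by (rule finite_PiE_dflt) auto

lemma card_labelings: "card (labelings n q) = q ^ n"
  by (simp add: labelings_def card_PiE_dflt)

lemma cross_freq_nonneg: "0 \<le> cross_freq n q S T"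
  by (simp add: cross_freq_def)

lemma cross_freq_empty: "1 \<le> q \<Longrightarrow> cross_freq n q {} {} = 1"
  by (simp add: cross_freq_def card_labelings)

lemma cross_freq_le_mono: "cross_freq n q S T \<le> cross_freq n q (S - T) {}"
  unfolding cross_freq_def
  by (intro divide_right_mono of_nat_mono card_mono) auto

text \<open>Exchanging two labellings off \<^term>\<open>verts S1\<close> is an involution on pairs of labellings; it
  expresses the independence of the labels on disjoint vertex sets.\<close>

lemma cross_freq_Un:
  assumes disj: "verts S1 \<inter> verts S2 = {}" and "T1 \<subseteq> S1" "T2 \<subseteq> S2" and q: "1 \<le> q"
  shows "cross_freq n q (S1 \<union> S2) (T1 \<union> T2) = cross_freq n q S1 T1 * cross_freq n q S2 T2"
proof -
  define E where "E S T = {\<sigma> \<in> labelings n q. S \<inter> crossing \<sigma> = T}" for S T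
  define mix :: "(nat \<Rightarrow> nat) \<Rightarrow> (nat \<Rightarrow> nat) \<Rightarrow> nat \<Rightarrow> nat"
    where "mix \<sigma> \<tau> = (\<lambda>i. if i \<in> verts S1 then \<sigma> i else \<tau> i)" for \<sigma> \<tau>
  have mix_lab: "mix \<sigma> \<tau> \<in> labelings n q" if "\<sigma> \<in> labelings n q" "\<tau> \<in> labelings n q" for \<sigma> \<tau>
    using that by (auto simp: labelings_def PiE_dflt_def mix_def)
  have mix1: "S1 \<inter> crossing (mix \<sigma> \<tau>) = S1 \<inter> crossing \<sigma>" for \<sigma> \<tau>
    using vertsI[of _ _ S1] by (auto simp: crossing_def mix_def)
  have mix2: "S2 \<inter> crossing (mix \<sigma> \<tau>) = S2 \<inter> crossing \<tau>" for \<sigma> \<tau>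
  proof -
    have "i \<notin> verts S1" "j \<notin> verts S1" if "(i, j) \<in> S2" for i j
      using disj vertsI[OF that] by blast+
    then show ?thesis by (auto simp: crossing_def mix_def)
  qed
  have split: "E (S1 \<union> S2) (T1 \<union> T2) = {\<sigma> \<in> labelings n q. S1 \<inter> crossing \<sigma> = T1 \<and> S2 \<inter> crossing \<sigma> = T2}"
    using assms disjoint_verts_imp_disjoint[OF disj] unfolding E_def by blast
  have mixmix [simp]: "mix (mix \<sigma> \<tau>) (mix \<tau> \<sigma>) = \<sigma>" for \<sigma> \<tau>
    by (auto simp: mix_def)
  have fwd: "mix \<sigma> \<tau> \<in> E (S1 \<union> S2) (T1 \<union> T2)" if "\<sigma> \<in> E S1 T1" "\<tau> \<in> E S2 T2" for \<sigma> \<tau>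
    unfolding split using that by (simp add: E_def mix_lab mix1 mix2)
  have bwd: "mix \<sigma> \<tau> \<in> E S1 T1" "mix \<tau> \<sigma> \<in> E S2 T2"
    if "\<sigma> \<in> E (S1 \<union> S2) (T1 \<union> T2)" "\<tau> \<in> labelings n q" for \<sigma> \<tau>
    using that unfolding split by (simp_all add: E_def mix_lab mix1 mix2)
  have Elab: "E S T \<subseteq> labelings n q" for S T by (auto simp: E_def)
  have "bij_betw (\<lambda>(\<sigma>, \<tau>). (mix \<sigma> \<tau>, mix \<tau> \<sigma>)) (E S1 T1 \<times> E S2 T2)
          (E (S1 \<union> S2) (T1 \<union> T2) \<times> labelings n q)"
    by (rule bij_betw_byWitness[where f' = "\<lambda>(\<sigma>, \<tau>). (mix \<sigma> \<tau>, mix \<tau> \<sigma>)"])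
       (use fwd bwd mix_lab subsetD[OF Elab] in \<open>auto simp del: Un_iff\<close>)
  from bij_betw_same_card[OF this]
  have "card (E (S1 \<union> S2) (T1 \<union> T2)) * q ^ n = card (E S1 T1) * card (E S2 T2)"
    by (simp add: card_cartesian_product card_labelings)
  then have "real (card (E (S1 \<union> S2) (T1 \<union> T2))) * real q ^ n
      = real (card (E S1 T1)) * real (card (E S2 T2))"
    by (metis of_nat_mult of_nat_power)
  then show ?thesis
    using q unfolding cross_freq_def E_def[symmetric] by (simp add: field_simps)
qed

text \<open>A labelling that is monochromatic on the edges of \<open>S - T\<close> is determined by its values
  off \<open>verts S - verts T\<close>: the edges of \<open>S\<close> do not leave the set where two such labellings agree.\<close>

lemma mono_freq_le:
  assumes conn: "edge_connected S" and S: "S \<subseteq> edges n" and T: "T \<subseteq> S" "T \<noteq> {}" and q: "1 \<le> q"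
  shows "cross_freq n q (S - T) {} \<le> (1 / real q) ^ card (verts S - verts T)"
proof -
  define A where "A = {1..n} - (verts S - verts T)"
  define E where "E = {\<sigma> \<in> labelings n q. (S - T) \<inter> crossing \<sigma> = {}}"
  have inj: "inj_on (\<lambda>\<sigma>. restrict \<sigma> A) E"
  proof (rule inj_onI)
    fix \<sigma> \<tau> assume *: "\<sigma> \<in> E" "\<tau> \<in> E" "restrict \<sigma> A = restrict \<tau> A"
    define W where "W = {i. \<sigma> i = \<tau> i}"
    have eqA: "i \<in> W" if "i \<in> A" for i
      using fun_cong[OF *(3), of i] that by (simp add: W_def)
    have TW: "verts T \<subseteq> W"
      using eqA verts_edges[OF S] verts_mono[OF T(1)] by (auto simp: A_def)
    define S1 where "S1 = {(i, j) \<in> S. i \<in> W}"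
    have closed: "i \<in> W \<longleftrightarrow> j \<in> W" if "(i, j) \<in> S" for i j
    proof (cases "(i, j) \<in> T")
      case True
      then have "i \<in> verts T" "j \<in> verts T" by (auto intro: vertsI)
      then show ?thesis using TW by auto
    next
      case False
      then have "\<sigma> i = \<sigma> j" "\<tau> i = \<tau> j" using * that by (auto simp: E_def crossing_def)
      then show ?thesis by (simp add: W_def)
    qed
    have v1: "verts S1 \<subseteq> W" using closed by (auto simp: S1_def verts_def)
    have v2: "verts (S - S1) \<inter> W = {}" using closed by (auto simp: S1_def verts_def)
    have "S = S1 \<union> (S - S1)" "verts S1 \<inter> verts (S - S1) = {}"
      using v1 v2 by (auto simp: S1_def)
    with conn have "S1 = {} \<or> S - S1 = {}" unfolding edge_connected_def by blast
    \<comment> \<open>Nonemptiness of \<open>T\<close> provides an edge with both endpoints in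
      \<open>W\<close>.\<close>
    moreover have "S1 \<noteq> {}" using T TW by (force simp: S1_def verts_def)
    ultimately have "verts S \<subseteq> W" using v1 verts_mono[of S S1] by blast
    then have "i \<in> W" if "i \<in> {1..n}" for i using that eqA by (auto simp: A_def)
    moreover have "i \<in> W" if "i \<notin> {1..n}" for i
      using *(1,2) that by (simp add: E_def labelings_def PiE_dflt_def W_def)
    ultimately show "\<sigma> = \<tau>" unfolding W_def by blast
  qed
  have "card E = card ((\<lambda>\<sigma>. restrict \<sigma> A) ` E)" using inj by (simp add: card_image)
  also have "\<dots> \<le> card (PiE A (\<lambda>_. {1..q}))"
  proof (rule card_mono)
    show "(\<lambda>\<sigma>. restrict \<sigma> A) ` E \<subseteq> PiE A (\<lambda>_. {1..q})"
    proof (intro image_subsetI PiE_I)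
      fix \<sigma> i assume \<sigma>: "\<sigma> \<in> E" and i: "i \<in> A"
      then have "\<sigma> i \<in> {1..q}" unfolding E_def labelings_def PiE_dflt_def A_def by blast
      with i show "restrict \<sigma> A i \<in> {1..q}" by simp
    qed simp
  qed (simp add: A_def finite_PiE)
  also have "\<dots> = q ^ card A" by (simp add: card_PiE A_def)
  finally have E: "real (card E) \<le> real q ^ card A" by (metis of_nat_le_iff of_nat_power)
  have sub: "verts S - verts T \<subseteq> {1..n}" using verts_edges[OF S] by auto
  then have cA: "n = card A + card (verts S - verts T)"
    using card_mono[OF _ sub] by (simp add: A_def card_Diff_subset finite_subset)
  have "cross_freq n q (S - T) {} \<le> real q ^ card A / real q ^ n"
    unfolding cross_freq_def using E by (intro divide_right_mono) (auto simp: E_def)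
  also have "real q ^ n = real q ^ card A * real q ^ card (verts S - verts T)"
    using cA by (metis power_add)
  also have "real q ^ card A / \<dots> = (1 / real q) ^ card (verts S - verts T)"
    using q by (simp add: power_divide)
  finally show ?thesis .
qed

text \<open>Connectivity forces one common label on \<open>verts S\<close>. It can be chosen in
  \<open>q\<close> ways while the labels elsewhere stay free, hence the exponent is one less than
  the number of vertices.\<close>

lemma mono_freq_connected:
  assumes conn: "edge_connected S" and S: "S \<subseteq> edges n" "S \<noteq> {}" and q: "1 \<le> q"
  shows "cross_freq n q S {} = (1 / real q) ^ (card (verts S) - 1)"
proof -
  define F where "F c = PiE_dflt {1..n} 0 (\<lambda>i. if i \<in> verts S then {c} else {1..q})" for c
  define V where "V = verts S"
  have V: "V \<subseteq> {1..n}" "V \<noteq> {}" "finite V"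
    using verts_edges[OF S(1)] S(2) finite_subset unfolding V_def by auto
  have const: "\<exists>c\<in>{1..q}. \<sigma> \<in> F c" if \<sigma>: "\<sigma> \<in> labelings n q" "S \<inter> crossing \<sigma> = {}" for \<sigma>
  proof -
    obtain x where x: "x \<in> V" using V by auto
    \<comment> \<open>These are the edges in the community of \<open>x\<close>. No edge of
      \<open>S\<close> leaves that community, so indecomposability makes \<open>S1\<close> all of
      \<open>S\<close>.\<close>
    define S1 where "S1 = {(i, j) \<in> S. \<sigma> i = \<sigma> x}"
    have e: "\<sigma> i = \<sigma> j" if "(i, j) \<in> S" for i j using \<sigma>(2) that by (auto simp: crossing_def)
    have v1: "\<sigma> i = \<sigma> x" if "i \<in> verts S1" for i
      using that e by (fastforce simp: S1_def verts_def)
    have v2: "\<sigma> i \<noteq> \<sigma> x" if "i \<in> verts (S - S1)" for i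
      using that e by (fastforce simp: S1_def verts_def)
    have "S = S1 \<union> (S - S1)" by (auto simp: S1_def)
    moreover have "verts S1 \<inter> verts (S - S1) = {}" using v1 v2 by blast
    ultimately have "S1 = {} \<or> S - S1 = {}" using conn unfolding edge_connected_def by blast
    moreover have "S1 \<noteq> {}" 
    proof
      assume "S1 = {}"
      with v2 x show False by (auto simp: V_def)
    qed
    ultimately have "S \<subseteq> S1" by blast
    then have "verts S \<subseteq> verts S1" by (rule verts_mono)
    then have "\<sigma> \<in> F (\<sigma> x)"
      using \<sigma>(1) v1 by (auto simp: F_def labelings_def PiE_dflt_def subset_iff)
    moreover have "\<sigma> x \<in> {1..q}" using \<sigma>(1) x V by (auto simp: labelings_def PiE_dflt_def)
    ultimately show ?thesis by blast
  qed
  have eq: "{\<sigma> \<in> labelings n q. S \<inter> crossing \<sigma> = {}} = (\<Union>c\<in>{1..q}. F c)"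
  proof (intro equalityI subsetI)
    fix \<sigma> assume "\<sigma> \<in> (\<Union>c\<in>{1..q}. F c)"
    then obtain c where c: "c \<in> {1..q}" "\<sigma> \<in> F c" by blast
    have l: "\<sigma> \<in> labelings n q"
      unfolding labelings_def PiE_dflt_def
    proof (intro CollectI allI conjI impI)
      fix i assume "i \<in> {1..n}" then show "\<sigma> i \<in> {1..q}"
        using c by (cases "i \<in> verts S") (auto simp: F_def PiE_dflt_def)
    next
      fix i assume "i \<notin> {1..n}" then show "\<sigma> i = 0" using c by (simp add: F_def PiE_dflt_def)
    qed
    have k: "\<sigma> i = c" if "i \<in> verts S" for i
    proof -
      have "i \<in> {1..n}" using that V by (auto simp: V_def)
      then show ?thesis using c(2) that by (auto simp: F_def PiE_dflt_def)
    qed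
    have "\<sigma> i = c" "\<sigma> j = c" if "(i, j) \<in> S" for i j
      using k vertsI[OF that] by blast+
    then have "S \<inter> crossing \<sigma> = {}" by (fastforce simp: crossing_def)
    with l show "\<sigma> \<in> {\<sigma> \<in> labelings n q. S \<inter> crossing \<sigma> = {}}" by blast
  qed (use const in blast)
  have fin: "finite (F c)" for c unfolding F_def by (rule finite_PiE_dflt) auto
  have disj: "F c \<inter> F d = {}" if "c \<noteq> d" for c d
  proof -
    obtain x where x: "x \<in> V" using V by auto
    then have "x \<in> verts S" "x \<in> {1..n}" using V by (auto simp: V_def)
    then have "\<sigma> x = c" if "\<sigma> \<in> F c" for \<sigma> c
      using that unfolding F_def PiE_dflt_def by (metis (no_types, lifting) mem_Collect_eq singletonD)
    then show ?thesis using that by blast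
  qed
  have cF: "card (F c) = q ^ (n - card V)" for c
  proof -
    have "card (F c) = (\<Prod>i\<in>{1..n}. card (if i \<in> V then {c} else {1..q}))"
      unfolding F_def V_def by (subst card_PiE_dflt) auto
    also have "\<dots> = (\<Prod>i\<in>{1..n}. if i \<in> V then 1 else q)" by (intro prod.cong) auto
    also have "\<dots> = q ^ card ({1..n} - V)"
      by (simp add: prod.If_cases Diff_eq)
    finally show ?thesis using V by (simp add: card_Diff_subset)
  qed
  have "card (\<Union>c\<in>{1..q}. F c) = q * q ^ (n - card V)"
    using fin disj by (subst card_UN_disjoint) (auto simp: cF)
  then have "cross_freq n q S {} = real q * real q ^ (n - card V) / real q ^ n"
    unfolding cross_freq_def eq by simp
  \<comment> \<open>The truncated subtractions are exact because \<open>V\<close> is nonempty and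
    has at most \<open>n\<close> elements.\<close>
  moreover have "n = (n - card V) + (card V - 1) + 1"
    using card_mono[OF _ V(1)] card_gt_0_iff[of V] V by simp
  then have "real q ^ n = real q ^ (n - card V) * real q ^ (card V - 1) * real q"
    by (metis power_add power_one_right)
  ultimately show ?thesis using q by (simp add: V_def power_divide)
qed

lemma edge_connected_singleton: "edge_connected {e}"
  unfolding edge_connected_def by (metis (no_types) Un_iff Un_upper1 Un_upper2 inf.idem subset_singletonD verts_eq_empty_iff)

text \<open>Union bound: each single edge is monochromatic with probability \<open>1 / q\<close>.
  This keeps the diagonal of the triangular system away from 0 when \<open>S\<close> has few edges
  compared with \<open>q\<close>.\<close>

lemma cross_freq_self_ge:
  assumes S: "S \<subseteq> edges n" and q: "1 \<le> q"
  shows "1 - real (card S) / real q \<le> cross_freq n q S S"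
proof -
  let ?L = "labelings n q"
  have "finite S" using S by (rule finite_subset) simp
  have one: "cross_freq n q {e} {} = 1 / real q" if "e \<in> S" for e
  proof -
    have e: "{e} \<subseteq> edges n" using S that by auto
    have "card (verts {e}) = 2"
      using card_verts_ge_2[OF e] card_verts_le[of "{e}"] by simp
    with mono_freq_connected[OF edge_connected_singleton e _ q] show ?thesis by simp
  qed
  have "?L \<subseteq> {\<sigma> \<in> ?L. S \<inter> crossing \<sigma> = S} \<union> (\<Union>e\<in>S. {\<sigma> \<in> ?L. {e} \<inter> crossing \<sigma> = {}})"
    by auto
  then have "card ?L \<le> card ({\<sigma> \<in> ?L. S \<inter> crossing \<sigma> = S} \<union> (\<Union>e\<in>S. {\<sigma> \<in> ?L. {e} \<inter> crossing \<sigma> = {}}))"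
    using \<open>finite S\<close> by (intro card_mono) auto
  also have "\<dots> \<le> card {\<sigma> \<in> ?L. S \<inter> crossing \<sigma> = S}
      + (\<Sum>e\<in>S. card {\<sigma> \<in> ?L. {e} \<inter> crossing \<sigma> = {}})"
    by (rule order.trans[OF card_Un_le]) (intro add_left_mono card_UN_le \<open>finite S\<close>)
  finally have "real (card ?L) \<le> real (card {\<sigma> \<in> ?L. S \<inter> crossing \<sigma> = S})
      + (\<Sum>e\<in>S. real (card {\<sigma> \<in> ?L. {e} \<inter> crossing \<sigma> = {}}))"
    by (simp only: of_nat_add[symmetric] of_nat_sum[symmetric] of_nat_le_iff)
  then have "real (card ?L) / real q ^ n \<le> (real (card {\<sigma> \<in> ?L. S \<inter> crossing \<sigma> = S})
      + (\<Sum>e\<in>S. real (card {\<sigma> \<in> ?L. {e} \<inter> crossing \<sigma> = {}}))) / real q ^ n"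
    by (intro divide_right_mono) auto
  also have "\<dots> = cross_freq n q S S + (\<Sum>e\<in>S. cross_freq n q {e} {})"
    by (simp add: cross_freq_def add_divide_distrib sum_divide_distrib)
  also have "\<dots> = cross_freq n q S S + real (card S) / real q" using one by simp
  finally show ?thesis using q by (simp add: card_labelings)
qed


section \<open>The dual weights\<close>

text \<open>Forward substitution for the triangular system of the overview, the divisor being the
  diagonal entry. The guard \<open>finite S\<close> makes \<open>card\<close> decrease along proper
  subsets.\<close>

function dual_weight :: "nat \<Rightarrow> nat \<Rightarrow> nat \<Rightarrow> (nat \<times> nat) set \<Rightarrow> real" where
  "dual_weight n q q' S =
     (if finite S
      then (cross_freq n q S {} - (\<Sum>T | T \<subset> S. dual_weight n q q' T * cross_freq n q' S T))
             / cross_freq n q' S S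
      else 0)"
  by pat_completeness auto
termination
  by (relation "Wellfounded.measure (\<lambda>(n, q, q', S). card S)") (auto intro: psubset_card_mono)

declare dual_weight.simps [simp del]

lemma sum_Pow_eq_psubsets:
  assumes "finite S"
  shows "(\<Sum>T\<in>Pow S. f T) = (\<Sum>T | T \<subset> S. f T) + (f S :: real)"
proof -
  have "Pow S = insert S {T. T \<subset> S}" by auto
  moreover have "finite {T. T \<subset> S}" by (rule finite_subset[of _ "Pow S"]) (use assms in auto)
  ultimately show ?thesis by simp
qed

lemma dual_weight_sum:
  assumes "finite S" "cross_freq n q' S S \<noteq> 0"
  shows "(\<Sum>T\<in>Pow S. dual_weight n q q' T * cross_freq n q' S T) = cross_freq n q S {}"
  using assms by (subst sum_Pow_eq_psubsets) (simp_all add: dual_weight.simps[of n q q' S])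

lemma dual_weight_empty: "1 \<le> q \<Longrightarrow> 1 \<le> q' \<Longrightarrow> dual_weight n q q' {} = 1"
  by (simp add: dual_weight.simps cross_freq_empty)

lemma sum_Pow_Un:
  assumes "A \<inter> B = {}"
  shows "(\<Sum>T\<in>Pow (A \<union> B). f T) = (\<Sum>(X, Y)\<in>Pow A \<times> Pow B. f (X \<union> Y) :: real)"
proof -
  have "bij_betw (\<lambda>(X, Y). X \<union> Y) (Pow A \<times> Pow B) (Pow (A \<union> B))"
    by (rule bij_betw_byWitness[where f' = "\<lambda>T. (T \<inter> A, T \<inter> B)"]) (use assms in auto)
  from sum.reindex_bij_betw[OF this, of f] show ?thesis by (simp add: case_prod_unfold)
qed

text \<open>As \<open>cross_freq\<close> factorises, products of weights solve the same triangular
  system as the weights of unions, and nonzero diagonal entries make the solution unique. The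
  induction matches all terms but the top one, which can then be compared.\<close>

lemma dual_weight_Un:
  assumes "finite S1" "finite S2" "verts S1 \<inter> verts S2 = {}" "1 \<le> q" "1 \<le> q'"
    and "\<And>T. T \<subseteq> S1 \<union> S2 \<Longrightarrow> cross_freq n q' T T \<noteq> 0"
  shows "dual_weight n q q' (S1 \<union> S2) = dual_weight n q q' S1 * dual_weight n q q' S2"
  using assms
proof (induction "card (S1 \<union> S2)" arbitrary: S1 S2 rule: less_induct)
  case less
  let ?w = "dual_weight n q q'" and ?M = "\<lambda>S T. cross_freq n q' S T"
  have fin: "finite (S1 \<union> S2)" using less by simp
  have disj: "S1 \<inter> S2 = {}" using less.prems(3) by (rule disjoint_verts_imp_disjoint)
  have M: "?M (S1 \<union> S2) (X \<union> Y) = ?M S1 X * ?M S2 Y" if "X \<subseteq> S1" "Y \<subseteq> S2" for X Y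
    using cross_freq_Un[OF less.prems(3) that less.prems(5)] .
  \<comment> \<open>Since \<open>S1\<close> and \<open>S2\<close> are disjoint, every pair other
    than the full one has a strictly smaller union.\<close>
  have IH: "?w (X \<union> Y) = ?w X * ?w Y" if "X \<subseteq> S1" "Y \<subseteq> S2" "(X, Y) \<noteq> (S1, S2)" for X Y
  proof (rule less.hyps)
    have "X \<union> Y \<subset> S1 \<union> S2" using that disj by blast
    then show "card (X \<union> Y) < card (S1 \<union> S2)" using fin by (rule psubset_card_mono[rotated])
    show "verts X \<inter> verts Y = {}"
      using less.prems(3) verts_mono[OF that(1)] verts_mono[OF that(2)] by blast
    show "finite X" "finite Y"
      using that less.prems finite_subset by blast+
    show "cross_freq n q' T T \<noteq> 0" if "T \<subseteq> X \<union> Y" for T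
      using that \<open>X \<subseteq> S1\<close> \<open>Y \<subseteq> S2\<close> by (intro less.prems) auto
  qed (use less.prems in auto)
  let ?P = "Pow S1 \<times> Pow S2"
  have fP: "finite ?P" using fin by simp
  have mem: "(S1, S2) \<in> ?P" by simp
  \<comment> \<open>The right-hand sides factorise too, so the equation for the union is the product
    of the two equations.\<close>
  have "cross_freq n q (S1 \<union> S2) ({} \<union> {}) = cross_freq n q S1 {} * cross_freq n q S2 {}"
    by (rule cross_freq_Un) (use less.prems in auto)
  then have "(\<Sum>T\<in>Pow (S1 \<union> S2). ?w T * ?M (S1 \<union> S2) T)
      = (\<Sum>X\<in>Pow S1. ?w X * ?M S1 X) * (\<Sum>Y\<in>Pow S2. ?w Y * ?M S2 Y)"
    using less.prems by (simp add: dual_weight_sum)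
  also have "\<dots> = (\<Sum>(X, Y)\<in>?P. ?w X * ?w Y * (?M S1 X * ?M S2 Y))"
    unfolding sum_product sum.cartesian_product by (intro sum.cong) auto
  also have "\<dots> = ?w S1 * ?w S2 * (?M S1 S1 * ?M S2 S2)
      + (\<Sum>(X, Y)\<in>?P - {(S1, S2)}. ?w X * ?w Y * (?M S1 X * ?M S2 Y))"
    by (subst sum.remove[OF fP mem]) simp
  also have "(\<Sum>T\<in>Pow (S1 \<union> S2). ?w T * ?M (S1 \<union> S2) T)
      = (\<Sum>(X, Y)\<in>?P. ?w (X \<union> Y) * (?M S1 X * ?M S2 Y))"
    unfolding sum_Pow_Un[OF disj] by (intro sum.cong) (auto simp: M)
  also have "\<dots> = ?w (S1 \<union> S2) * (?M S1 S1 * ?M S2 S2)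
      + (\<Sum>(X, Y)\<in>?P - {(S1, S2)}. ?w (X \<union> Y) * (?M S1 X * ?M S2 Y))"
    by (subst sum.remove[OF fP mem]) simp
  also have "(\<Sum>(X, Y)\<in>?P - {(S1, S2)}. ?w (X \<union> Y) * (?M S1 X * ?M S2 Y))
      = (\<Sum>(X, Y)\<in>?P - {(S1, S2)}. ?w X * ?w Y * (?M S1 X * ?M S2 Y))"
  proof (rule sum.cong[OF refl])
    fix z assume z: "z \<in> ?P - {(S1, S2)}"
    obtain X Y where XY: "z = (X, Y)" by (cases z)
    have "?w (X \<union> Y) = ?w X * ?w Y" using z unfolding XY by (intro IH) auto
    then show "(case z of (X, Y) \<Rightarrow> ?w (X \<union> Y) * (?M S1 X * ?M S2 Y))
        = (case z of (X, Y) \<Rightarrow> ?w X * ?w Y * (?M S1 X * ?M S2 Y))"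
      by (simp add: XY)
  qed
  finally have "?w (S1 \<union> S2) * (?M S1 S1 * ?M S2 S2) = ?w S1 * ?w S2 * (?M S1 S1 * ?M S2 S2)"
    by simp
  moreover have "?M S1 S1 \<noteq> 0" "?M S2 S2 \<noteq> 0" using less.prems(6) by auto
  ultimately show ?case by simp
qed

section \<open>Size of the dual weights\<close>

lemma sum_Pow_power: "finite S \<Longrightarrow> (\<Sum>T\<in>Pow S. x ^ card T) = (1 + x :: real) ^ card S"
proof -
  assume "finite S"
  have "(\<Prod>i\<in>S. x + 1) = (\<Sum>T\<in>Pow S. (\<Prod>i\<in>T. x) * (\<Prod>i\<in>S - T. 1))"
    by (rule prod_add[OF \<open>finite S\<close>])
  then show ?thesis by (simp add: add.commute)
qed

text \<open>A mean value estimate, later applied to powers of \<open>1 / q\<close> and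
  \<open>1 / (q + l)\<close>.\<close>

lemma power_diff_le_mult:
  fixes x y :: real
  assumes "0 \<le> y" "y \<le> x"
  shows "x ^ k - y ^ k \<le> real k * x ^ (k - 1) * (x - y)"
proof (induction k)
  case (Suc k)
  have "x ^ Suc k - y ^ Suc k = x * (x ^ k - y ^ k) + y ^ k * (x - y)"
    by (simp add: algebra_simps)
  also have "\<dots> \<le> x * (real k * x ^ (k - 1) * (x - y)) + x ^ k * (x - y)"
    using Suc assms by (intro add_mono mult_left_mono mult_right_mono power_mono) auto
  also have "\<dots> = real (Suc k) * x ^ (Suc k - 1) * (x - y)"
    by (cases k) (auto simp: algebra_simps)
  finally show ?case .
qed simp

text \<open>The bound is multiplicative, so vertex-disjoint unions follow from
  \<open>dual_weight_Un\<close>. For connected \<open>S\<close>, the mean gap and the nonempty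
  proper subsets each contribute at most a quarter of the bound, and dividing by the diagonal entry
  costs a factor of at most 2.\<close>

lemma dual_weight_bound:
  fixes n q l N :: nat and \<rho> :: real
  defines "A \<equiv> 8 * real N"
  assumes q: "1 \<le> q" "2 * N \<le> q" and l: "1 \<le> l"
    and \<rho>: "0 < \<rho>" "real l / real q ^ 2 \<le> \<rho> ^ 2"
    and S: "S \<subseteq> edges n" "card S \<le> N"
  shows "\<bar>dual_weight n q (q + l) S\<bar> \<le> A ^ card S * \<rho> ^ card (verts S)"
  using S
proof (induction "card S" arbitrary: S rule: less_induct)
  case less
  let ?w = "dual_weight n q (q + l)" and ?M = "\<lambda>S T. cross_freq n (q + l) S T"
  have fin: "finite S" using less.prems by (meson finite_edges finite_subset)
  have half: "1 / 2 \<le> ?M T T" if "T \<subseteq> S" for T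
  proof -
    have "card T \<le> N" using card_mono[OF fin that] less.prems by simp
    then have "real (card T) / real (q + l) \<le> 1 / 2" using q by (simp add: field_simps)
    moreover have "1 - real (card T) / real (q + l) \<le> ?M T T"
      using that less.prems q by (intro cross_freq_self_ge) auto
    ultimately show ?thesis by linarith
  qed
  consider "S = {}" | S1 S2 where "S = S1 \<union> S2" "verts S1 \<inter> verts S2 = {}" "S1 \<noteq> {}" "S2 \<noteq> {}"
    | "S \<noteq> {}" "edge_connected S"
    unfolding edge_connected_def by blast
  then show ?case
  proof cases
    case 1
    then show ?thesis using q l by (simp add: dual_weight_empty)
  next
    case 2
    have fin12: "finite S1" "finite S2" using 2 fin by auto
    have disj: "S1 \<inter> S2 = {}" using 2 by (intro disjoint_verts_imp_disjoint)
    have card: "card S = card S1 + card S2" using disj fin12 2 by (simp add: card_Un_disjoint)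
    have cardv: "card (verts S) = card (verts S1) + card (verts S2)"
      using 2 fin12 by (simp add: verts_Un card_Un_disjoint finite_verts)
    have pos: "0 < card S1" "0 < card S2" using 2 fin12 by (auto simp: card_gt_0_iff)
    have "?w S = ?w S1 * ?w S2"
      unfolding 2(1)
    proof (rule dual_weight_Un)
      fix T assume "T \<subseteq> S1 \<union> S2" then show "?M T T \<noteq> 0" using half[of T] 2(1) by auto
    qed (use 2 fin12 q in auto)
    then have "\<bar>?w S\<bar> = \<bar>?w S1\<bar> * \<bar>?w S2\<bar>" by (simp add: abs_mult)
    also have "\<dots> \<le> (A ^ card S1 * \<rho> ^ card (verts S1)) * (A ^ card S2 * \<rho> ^ card (verts S2))"
      using less.hyps[of S1] less.hyps[of S2] less.prems card pos 2(1) \<rho>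
      by (intro mult_mono) (auto simp: A_def)
    also have "\<dots> = A ^ card S * \<rho> ^ card (verts S)" by (simp add: card cardv power_add)
    finally show ?thesis .
  next
    case 3
    define v where "v = card (verts S)"
    define e where "e = card S"
    have v2: "2 \<le> v" unfolding v_def using less.prems 3 by (intro card_verts_ge_2)
    have ve: "v \<le> 2 * e" unfolding v_def e_def using fin by (rule card_verts_le)
    have e1: "1 \<le> e" using 3 fin by (simp add: e_def Suc_le_eq card_gt_0_iff)
    have eN: "e \<le> N" using less.prems by (simp add: e_def)
    have A8: "8 * real e \<le> A" "8 \<le> A" using eN e1 by (auto simp: A_def)
    \<comment> \<open>Since \<open>l\<close> is at least 1, a single factor \<open>1 / q\<close> is
      at most \<open>\<rho>\<close>, so spare powers of \<open>1 / q\<close> can be traded for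
      powers of \<open>\<rho>\<close>.\<close>
    have "(1 / real q) ^ 2 \<le> real l / real q ^ 2" using l by (simp add: power_divide divide_right_mono)
    then have "(1 / real q) ^ 2 \<le> \<rho> ^ 2" using \<rho> by linarith
    then have q\<rho>: "1 / real q \<le> \<rho>" by (rule power2_le_imp_le) (use \<rho> in auto)
    \<comment> \<open>The difference of the two inverses supplies \<open>\<rho> ^ 2\<close>, the
      other \<open>v - 2\<close> factors supply one \<open>\<rho>\<close> each, and the derivative
      factor \<open>v - 1\<close> is at most \<open>2 * e\<close>.\<close>
    have "\<bar>cross_freq n q S {} - cross_freq n (q + l) S {}\<bar> \<le> 2 * real e * \<rho> ^ v"
    proof -
      have qq: "1 / real (q + l) \<le> 1 / real q" using q by (simp add: frac_le)
      have df: "1 / real q - 1 / real (q + l) \<le> \<rho> ^ 2"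
      proof -
        have "1 / real q - 1 / real (q + l) = real l / (real q * real (q + l))"
          using q by (simp add: field_simps)
        also have "\<dots> \<le> real l / real q ^ 2"
          using q by (intro divide_left_mono) (auto simp: power2_eq_square intro!: mult_left_mono)
        finally show ?thesis using \<rho> by linarith
      qed
      have "cross_freq n q S {} - cross_freq n (q + l) S {}
          = (1 / real q) ^ (v - 1) - (1 / real (q + l)) ^ (v - 1)"
        using 3 less.prems q by (simp add: mono_freq_connected v_def)
      moreover have "\<dots> \<le> real (v - 1) * (1 / real q) ^ (v - 1 - 1) * (1 / real q - 1 / real (q + l))"
        using qq by (intro power_diff_le_mult) auto
      moreover have "\<dots> \<le> (2 * real e) * \<rho> ^ (v - 1 - 1) * \<rho> ^ 2"
        using qq df q\<rho> ve \<rho> by (intro mult_mono power_mono) auto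
      moreover have "\<dots> = 2 * real e * \<rho> ^ v"
      proof -
        have "v = (v - 1 - 1) + 2" using v2 by simp
        then have "\<rho> ^ v = \<rho> ^ (v - 1 - 1) * \<rho> ^ 2" by (metis power_add)
        then show ?thesis by simp
      qed
      moreover have "(1 / real (q + l)) ^ (v - 1) \<le> (1 / real q) ^ (v - 1)"
        using qq by (intro power_mono) auto
      ultimately show ?thesis by linarith
    qed
    moreover have "2 * real e * \<rho> ^ v \<le> A ^ e / 4 * \<rho> ^ v"
    proof -
      have "A \<le> A ^ e" using A8 e1 self_le_power[of A e] by simp
      then show ?thesis using A8 \<rho> by (intro mult_right_mono) auto
    qed
    ultimately have first: "\<bar>cross_freq n q S {} - cross_freq n (q + l) S {}\<bar> \<le> A ^ e / 4 * \<rho> ^ v"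
      by linarith
    \<comment> \<open>Induction pays one \<open>\<rho>\<close> per vertex of \<open>T\<close>, and
      \<open>mono_freq_le\<close> one per remaining vertex of \<open>S\<close>. For
      \<open>T = {}\<close> only \<open>v - 1\<close> factors would be available, so that term is
      treated separately.\<close>
    have step: "\<bar>?w T * ?M S T\<bar> \<le> A ^ card T * \<rho> ^ v" if T: "T \<subset> S" "T \<noteq> {}" for T
    proof -
      have cT: "card T < card S" using T fin by (simp add: psubset_card_mono)
      have vT: "verts T \<subseteq> verts S" using T by (intro verts_mono) auto
      have "\<bar>?w T\<bar> \<le> A ^ card T * \<rho> ^ card (verts T)"
        using less.hyps[of T] cT T less.prems by auto
      moreover have "?M S T \<le> \<rho> ^ card (verts S - verts T)"
      proof -
        have "?M S T \<le> ?M (S - T) {}" by (rule cross_freq_le_mono)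
        also have "\<dots> \<le> (1 / real (q + l)) ^ card (verts S - verts T)"
          using 3 T less.prems q by (intro mono_freq_le) auto
        also have "\<dots> \<le> \<rho> ^ card (verts S - verts T)"
        proof (rule power_mono)
          have "1 / real (q + l) \<le> 1 / real q" using q by (simp add: frac_le)
          then show "1 / real (q + l) \<le> \<rho>" using q\<rho> by linarith
        qed simp
        finally show ?thesis .
      qed
      ultimately have "\<bar>?w T\<bar> * ?M S T
          \<le> (A ^ card T * \<rho> ^ card (verts T)) * \<rho> ^ card (verts S - verts T)"
        using \<rho> by (intro mult_mono) (auto simp: cross_freq_nonneg A_def)
      also have "\<dots> = A ^ card T * \<rho> ^ (card (verts T) + card (verts S - verts T))"
        by (simp add: power_add)
      also have "card (verts T) + card (verts S - verts T) = v"
        using vT fin card_mono[OF finite_verts[OF fin] vT]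
        by (simp add: v_def card_Diff_subset finite_verts finite_subset)
      finally show ?thesis by (simp add: abs_mult cross_freq_nonneg)
    qed
    have psub: "{T. T \<subset> S} = insert {} {T. T \<subset> S \<and> T \<noteq> {}}" using 3 by auto
    have finp: "finite {T. T \<subset> S \<and> T \<noteq> {}}" by (rule finite_subset[of _ "Pow S"]) (use fin in auto)
    have sumbd: "\<bar>\<Sum>T | T \<subset> S \<and> T \<noteq> {}. ?w T * ?M S T\<bar> \<le> A ^ e / 4 * \<rho> ^ v"
    proof -
      have "\<bar>\<Sum>T | T \<subset> S \<and> T \<noteq> {}. ?w T * ?M S T\<bar> \<le> (\<Sum>T | T \<subset> S \<and> T \<noteq> {}. A ^ card T * \<rho> ^ v)"
        using step by (intro order.trans[OF sum_abs] sum_mono) auto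
      \<comment> \<open>Restoring the empty set completes the binomial sum, up to the top term
        \<open>A ^ e\<close>.\<close>
      also have "\<dots> \<le> (\<Sum>T | T \<subset> S. A ^ card T * \<rho> ^ v)"
        using \<rho> finp unfolding psub by (intro sum_mono2) (auto simp: A_def)
      also have "\<dots> = ((\<Sum>T\<in>Pow S. A ^ card T) - A ^ e) * \<rho> ^ v"
        by (simp add: sum_Pow_eq_psubsets[OF fin] e_def sum_distrib_right)
      also have "\<dots> = ((1 + A) ^ e - A ^ e) * \<rho> ^ v"
        by (simp add: sum_Pow_power[OF fin] e_def)
      also have "\<dots> \<le> A ^ e / 4 * \<rho> ^ v"
      proof (rule mult_right_mono)
        \<comment> \<open>The constant 8 in \<open>A\<close> gives \<open>e / A \<le> 1 / 8\<close>,
          and \<open>exp (1 / 8)\<close> is below \<open>5 / 4\<close>.\<close>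
        have "(1 + A) ^ e = A ^ e * (1 + 1 / A) ^ e"
          using A8 by (simp add: power_mult_distrib[symmetric] distrib_left add.commute)
        also have "(1 + 1 / A) ^ e \<le> exp (1 / A) ^ e"
          using A8 by (intro power_mono[OF exp_ge_add_one_self]) simp
        also have "exp (1 / A) ^ e = exp (real e / A)" using exp_of_nat_mult[of e "1 / A"] by simp
        also have "\<dots> \<le> exp (1 / 8)" using A8 by (simp add: field_simps)
        also have "exp (1 / 8 :: real) \<le> 1 + 1 / 8 + (1 / 8)\<^sup>2" by (rule exp_bound) auto
        also have "\<dots> \<le> 5 / 4" by (simp add: power2_eq_square)
        finally have "(1 + A) ^ e \<le> A ^ e * (5 / 4)" using A8 by simp
        then show "(1 + A) ^ e - A ^ e \<le> A ^ e / 4" by simp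
      qed (use \<rho> in simp)
      finally show ?thesis .
    qed
    \<comment> \<open>The empty set has weight 1, so its term is the mean under \<open>q + l\<close>
      and turns the right-hand side into the mean gap.\<close>
    have "(\<Sum>T | T \<subset> S. ?w T * ?M S T) = ?M S {} + (\<Sum>T | T \<subset> S \<and> T \<noteq> {}. ?w T * ?M S T)"
      using finp q l unfolding psub by (subst sum.insert) (auto simp: dual_weight_empty)
    then have "?w S * ?M S S = (cross_freq n q S {} - cross_freq n (q + l) S {})
        - (\<Sum>T | T \<subset> S \<and> T \<noteq> {}. ?w T * ?M S T)"
      using half[of S] fin by (simp add: dual_weight.simps[of n q "q + l" S])
    then have "\<bar>?w S * ?M S S\<bar> \<le> A ^ e / 2 * \<rho> ^ v" using first sumbd by linarith
    moreover have "\<bar>?w S\<bar> * (1 / 2) \<le> \<bar>?w S * ?M S S\<bar>"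
      unfolding abs_mult using half[of S] by (intro mult_left_mono) auto
    ultimately show ?thesis by (simp add: e_def v_def)
  qed
qed


section \<open>Moments of low-degree polynomials\<close>

definition multilinear_form :: "nat \<Rightarrow> nat \<Rightarrow> ((nat \<times> nat) set \<Rightarrow> real) \<Rightarrow> graph \<Rightarrow> real" where
  "multilinear_form n d c Y = (\<Sum>S | S \<subseteq> edges n \<and> card S \<le> d. c S * (\<Prod>e\<in>S. Y e))"

lemma finite_edge_sets [simp]: "finite {S. S \<subseteq> edges n \<and> P S}"
  by (rule finite_subset[of _ "Pow (edges n)"]) auto

section \<open>Characters and expectations under the model\<close>

lemma set_MC_given_labels:
  assumes "Y \<in> set_pmf (MC_given_labels n \<sigma>)" "e \<in> edges n"
  shows "Y e \<in> {1, -1}"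
proof -
  have "Y e \<in> set_pmf ((\<lambda>(i, j). if \<sigma> i = \<sigma> j then return_pmf 1 else pmf_of_set {1, -1}) e)"
    using assms by (simp add: MC_given_labels_def set_Pi_pmf PiE_dflt_def del: split_paired_All)
  then show ?thesis by (auto split: if_splits prod.splits)
qed

lemma finite_set_MC_given_labels: "finite (set_pmf (MC_given_labels n \<sigma>))"
  unfolding MC_given_labels_def
  by (subst set_Pi_pmf) (auto intro!: finite_PiE_dflt split: prod.splits)

lemma community_labels_eq: "1 \<le> q \<Longrightarrow> community_labels n q = pmf_of_set (labelings n q)"
  unfolding community_labels_def labelings_def by (rule Pi_pmf_of_set) auto

lemma labelings_nonempty: "1 \<le> q \<Longrightarrow> labelings n q \<noteq> {}"
  using card_labelings[of n q] by force

lemma finite_set_MC: "1 \<le> q \<Longrightarrow> finite (set_pmf (MC n q))"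
  by (auto simp: MC_def community_labels_eq labelings_nonempty finite_set_MC_given_labels)

lemma expectation_MC:
  fixes f :: "graph \<Rightarrow> real"
  assumes "1 \<le> q"
  shows "measure_pmf.expectation (MC n q) f
    = (\<Sum>\<sigma>\<in>labelings n q. measure_pmf.expectation (MC_given_labels n \<sigma>) f) / real q ^ n"
proof -
  have "measure_pmf.expectation (MC n q) f = (\<Sum>\<sigma>\<in>labelings n q.
      pmf (community_labels n q) \<sigma> *\<^sub>R measure_pmf.expectation (MC_given_labels n \<sigma>) f)"
    unfolding MC_def using assms
    by (intro pmf_expectation_bind)
       (simp_all add: finite_set_MC_given_labels community_labels_eq labelings_nonempty)
  then show ?thesis
    using assms by (simp add: community_labels_eq labelings_nonempty card_labelings sum_divide_distrib)
qed

lemma expectation_prod_Pi_pmf_finite: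
  fixes f :: "'a \<Rightarrow> 'b \<Rightarrow> real"
  assumes A: "finite A" and p: "\<And>x. x \<in> A \<Longrightarrow> finite (set_pmf (p x))"
  shows "measure_pmf.expectation (Pi_pmf A d p) (\<lambda>y. \<Prod>x\<in>A. f x (y x))
    = (\<Prod>x\<in>A. measure_pmf.expectation (p x) (f x))"
proof -
  let ?P = "measure_pmf (Pi_pmf A d p)"
  have "prob_space.indep_vars ?P (\<lambda>_. count_space UNIV) (\<lambda>x y. y x) A"
    using A by (rule indep_vars_Pi_pmf)
  then have indep: "prob_space.indep_vars ?P (\<lambda>_. borel) (\<lambda>x y. f x (y x)) A"
    by (rule prob_space.indep_vars_compose2[OF prob_space_measure_pmf]) auto
  have comp: "map_pmf (\<lambda>y. y x) (Pi_pmf A d p) = p x" if "x \<in> A" for x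
    using A that by (simp add: Pi_pmf_component)
  have int: "integrable ?P (\<lambda>y. f x (y x))" if "x \<in> A" for x
  proof -
    have "integrable (map_pmf (\<lambda>y. y x) (Pi_pmf A d p)) (f x)"
      unfolding comp[OF that] using p[OF that] by (rule integrable_measure_pmf_finite)
    then show ?thesis by simp
  qed
  have "measure_pmf.expectation (Pi_pmf A d p) (\<lambda>y. \<Prod>x\<in>A. f x (y x))
      = (\<Prod>x\<in>A. measure_pmf.expectation (Pi_pmf A d p) (\<lambda>y. f x (y x)))"
    using A indep int by (rule prob_space.indep_vars_lebesgue_integral[OF prob_space_measure_pmf])
  also have "\<dots> = (\<Prod>x\<in>A. measure_pmf.expectation (map_pmf (\<lambda>y. y x) (Pi_pmf A d p)) (f x))"
    by simp
  finally show ?thesis by (simp add: comp)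
qed

text \<open>Edges inside a community equal 1, so a character depends only on its crossing edges;
  characters of independent uniform signs are orthonormal.\<close>

lemma expectation_characters_given_labels:
  assumes "S \<subseteq> edges n" "S' \<subseteq> edges n"
  shows "measure_pmf.expectation (MC_given_labels n \<sigma>) (\<lambda>Y. (\<Prod>e\<in>S. Y e) * (\<Prod>e\<in>S'. Y e))
    = of_bool (S \<inter> crossing \<sigma> = S' \<inter> crossing \<sigma>)"
proof -
  \<comment> \<open>Padding with factors 1 writes the integrand as a product over all edges, to
    which independence applies.\<close>
  define f :: "nat \<times> nat \<Rightarrow> real \<Rightarrow> real"
    where "f e y = (if e \<in> S then y else 1) * (if e \<in> S' then y else 1)" for e y
  let ?p = "\<lambda>(i, j). if \<sigma> i = \<sigma> j then return_pmf 1 else pmf_of_set {1, -1::real}"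
  have prod_eq: "(\<Prod>e\<in>S. Y e) = (\<Prod>e\<in>edges n. if e \<in> S then Y e else 1)"
    if "S \<subseteq> edges n" for S and Y :: graph
    using that by (simp add: prod.If_cases Int_absorb1)
  have "(\<lambda>Y. (\<Prod>e\<in>S. Y e) * (\<Prod>e\<in>S'. Y e)) = (\<lambda>Y :: graph. \<Prod>e\<in>edges n. f e (Y e))"
    unfolding f_def prod.distrib using assms prod_eq by presburger
  then have "measure_pmf.expectation (MC_given_labels n \<sigma>) (\<lambda>Y. (\<Prod>e\<in>S. Y e) * (\<Prod>e\<in>S'. Y e))
      = (\<Prod>e\<in>edges n. measure_pmf.expectation (?p e) (f e))"
    unfolding MC_given_labels_def
    by (simp only:) (rule expectation_prod_Pi_pmf_finite, auto split: prod.splits)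
  also have "\<dots> = (\<Prod>e\<in>edges n. of_bool (e \<in> S \<inter> crossing \<sigma> \<longleftrightarrow> e \<in> S' \<inter> crossing \<sigma>))"
  proof (rule prod.cong[OF refl])
    fix e :: "nat \<times> nat"
    obtain i j where e: "e = (i, j)" by (cases e)
    show "measure_pmf.expectation (?p e) (f e) = of_bool (e \<in> S \<inter> crossing \<sigma> \<longleftrightarrow> e \<in> S' \<inter> crossing \<sigma>)"
      by (cases "\<sigma> i = \<sigma> j") (auto simp: e f_def crossing_def integral_pmf_of_set)
  qed
  also have "\<dots> = of_bool (\<forall>e\<in>edges n. e \<in> S \<inter> crossing \<sigma> \<longleftrightarrow> e \<in> S' \<inter> crossing \<sigma>)"
    by (cases "\<forall>e\<in>edges n. e \<in> S \<inter> crossing \<sigma> \<longleftrightarrow> e \<in> S' \<inter> crossing \<sigma>") (auto intro!: prod_zero)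
  also have "(\<forall>e\<in>edges n. e \<in> S \<inter> crossing \<sigma> \<longleftrightarrow> e \<in> S' \<inter> crossing \<sigma>)
      \<longleftrightarrow> S \<inter> crossing \<sigma> = S' \<inter> crossing \<sigma>"
    using assms by blast
  finally show ?thesis .
qed

lemma expectation_character_MC:
  assumes "S \<subseteq> edges n" "1 \<le> q"
  shows "measure_pmf.expectation (MC n q) (\<lambda>Y. \<Prod>e\<in>S. Y e) = cross_freq n q S {}"
proof -
  have "measure_pmf.expectation (MC_given_labels n \<sigma>) (\<lambda>Y. \<Prod>e\<in>S. Y e)
      = of_bool (S \<inter> crossing \<sigma> = {})" for \<sigma>
    using expectation_characters_given_labels[OF assms(1), of "{}" \<sigma>] by simp
  then show ?thesis
    using assms by (simp add: expectation_MC cross_freq_def of_bool_def sum.If_cases Int_def)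
qed

lemma expectation_multilinear_form:
  assumes "1 \<le> q"
  shows "measure_pmf.expectation (MC n q) (multilinear_form n d c)
    = (\<Sum>S | S \<subseteq> edges n \<and> card S \<le> d. c S * cross_freq n q S {})"
proof -
  have "measure_pmf.expectation (MC n q) (multilinear_form n d c)
      = (\<Sum>S | S \<subseteq> edges n \<and> card S \<le> d. measure_pmf.expectation (MC n q) (\<lambda>Y. c S * (\<Prod>e\<in>S. Y e)))"
    unfolding multilinear_form_def
    by (rule Bochner_Integration.integral_sum)
       (rule integrable_measure_pmf_finite[OF finite_set_MC[OF assms]])
  also have "\<dots> = (\<Sum>S | S \<subseteq> edges n \<and> card S \<le> d. c S * cross_freq n q S {})"
    using assms by (intro sum.cong) (auto simp: expectation_character_MC)
  finally show ?thesis .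
qed

text \<open>Given the labels, the crossing edges are independent signs, so this is Parseval's identity
  for the restricted form.\<close>

lemma second_moment_given_labels:
  "measure_pmf.expectation (MC_given_labels n \<sigma>) (\<lambda>Y. (multilinear_form n d c Y)\<^sup>2)
    = (\<Sum>T | T \<subseteq> edges n \<and> card T \<le> d.
         (\<Sum>S | S \<subseteq> edges n \<and> card S \<le> d. c S * of_bool (S \<inter> crossing \<sigma> = T))\<^sup>2)"
proof -
  define F where "F = {S. S \<subseteq> edges n \<and> card S \<le> d}"
  have F: "finite F" by (simp add: F_def)
  let ?E = "measure_pmf.expectation (MC_given_labels n \<sigma>)"
  have in_F: "S \<inter> crossing \<sigma> \<in> F" if "S \<in> F" for S
    using that card_mono[of S "S \<inter> crossing \<sigma>"] finite_subset[of S "edges n"] by (auto simp: F_def)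
  have int: "integrable (MC_given_labels n \<sigma>) f" for f :: "graph \<Rightarrow> real"
    by (rule integrable_measure_pmf_finite[OF finite_set_MC_given_labels])
  have "?E (\<lambda>Y. (multilinear_form n d c Y)\<^sup>2)
      = ?E (\<lambda>Y. \<Sum>S\<in>F. \<Sum>S'\<in>F. c S * c S' * ((\<Prod>e\<in>S. Y e) * (\<Prod>e\<in>S'. Y e)))"
    unfolding multilinear_form_def F_def[symmetric] power2_eq_square sum_product
    by (simp only: mult_ac)
  also have "\<dots> = (\<Sum>S\<in>F. \<Sum>S'\<in>F. c S * c S' * ?E (\<lambda>Y. (\<Prod>e\<in>S. Y e) * (\<Prod>e\<in>S'. Y e)))"
    by (simp add: Bochner_Integration.integral_sum int)
  also have "\<dots> = (\<Sum>S\<in>F. \<Sum>S'\<in>F. c S * c S' * of_bool (S \<inter> crossing \<sigma> = S' \<inter> crossing \<sigma>))"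
    by (intro sum.cong) (auto simp: F_def expectation_characters_given_labels)
  \<comment> \<open>Summing over the common pattern \<open>T\<close> separates the two indicators,
    so the double sum becomes a sum of squares.\<close>
  also have "\<dots> = (\<Sum>S\<in>F. \<Sum>S'\<in>F. \<Sum>T\<in>F.
      (c S * of_bool (S \<inter> crossing \<sigma> = T)) * (c S' * of_bool (S' \<inter> crossing \<sigma> = T)))"
  proof (intro sum.cong refl)
    fix S S' assume "S \<in> F" "S' \<in> F"
    have "(\<Sum>T\<in>F. (c S * of_bool (S \<inter> crossing \<sigma> = T)) * (c S' * of_bool (S' \<inter> crossing \<sigma> = T)))
        = (\<Sum>T\<in>F. if T = S \<inter> crossing \<sigma>
            then c S * c S' * of_bool (S \<inter> crossing \<sigma> = S' \<inter> crossing \<sigma>) else 0)"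
      by (intro sum.cong) auto
    then show "c S * c S' * of_bool (S \<inter> crossing \<sigma> = S' \<inter> crossing \<sigma>)
      = (\<Sum>T\<in>F. (c S * of_bool (S \<inter> crossing \<sigma> = T)) * (c S' * of_bool (S' \<inter> crossing \<sigma> = T)))"
      using F in_F[OF \<open>S \<in> F\<close>] by simp
  qed
  also have "\<dots> = (\<Sum>S\<in>F. \<Sum>T\<in>F. \<Sum>S'\<in>F.
      (c S * of_bool (S \<inter> crossing \<sigma> = T)) * (c S' * of_bool (S' \<inter> crossing \<sigma> = T)))"
    by (rule sum.cong[OF refl]) (rule sum.swap)
  also have "\<dots> = (\<Sum>T\<in>F. (\<Sum>S\<in>F. c S * of_bool (S \<inter> crossing \<sigma> = T))\<^sup>2)"
    unfolding power2_eq_square sum_product by (rule sum.swap)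
  finally show ?thesis by (simp add: F_def)
qed

text \<open>The conditional coefficients \<open>g \<sigma> T\<close> average to \<open>h T\<close>,
  Jensen bounds the square of \<open>h T\<close>, and Parseval sums the bounds to the second moment.
  Dropping \<open>T = {}\<close> subtracts exactly the squared mean.\<close>

lemma variance_multilinear_form_ge:
  assumes q: "1 \<le> q"
  shows "(\<Sum>T | T \<subseteq> edges n \<and> card T \<le> d \<and> T \<noteq> {}.
           (\<Sum>S | S \<subseteq> edges n \<and> card S \<le> d. c S * cross_freq n q S T)\<^sup>2)
    \<le> measure_pmf.variance (MC n q) (multilinear_form n d c)"
proof -
  define F where "F = {S. S \<subseteq> edges n \<and> card S \<le> d}"
  have F: "finite F" "{} \<in> F" by (simp_all add: F_def)
  define g where "g \<sigma> T = (\<Sum>S\<in>F. c S * of_bool (S \<inter> crossing \<sigma> = T))" for \<sigma> :: "nat \<Rightarrow> nat" and T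
  define h where "h T = (\<Sum>S\<in>F. c S * cross_freq n q S T)" for T
  let ?L = "labelings n q"
  have qn: "0 < real q ^ n" using q by simp
  have avg: "(\<Sum>\<sigma>\<in>?L. g \<sigma> T) = real q ^ n * h T" for T
  proof -
    have "(\<Sum>\<sigma>\<in>?L. g \<sigma> T) = (\<Sum>S\<in>F. c S * (\<Sum>\<sigma>\<in>?L. of_bool (S \<inter> crossing \<sigma> = T)))"
      unfolding g_def sum_distrib_left by (rule sum.swap)
    also have "\<dots> = (\<Sum>S\<in>F. c S * (real q ^ n * cross_freq n q S T))"
    proof (rule sum.cong[OF refl])
      fix S
      have "(\<Sum>\<sigma>\<in>?L. of_bool (S \<inter> crossing \<sigma> = T)) = real (card {\<sigma> \<in> ?L. S \<inter> crossing \<sigma> = T})"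
        by (simp add: of_bool_def sum.If_cases Int_def)
      then show "c S * (\<Sum>\<sigma>\<in>?L. of_bool (S \<inter> crossing \<sigma> = T)) = c S * (real q ^ n * cross_freq n q S T)"
        using q by (simp add: cross_freq_def)
    qed
    finally show ?thesis by (simp add: h_def sum_distrib_left mult_ac)
  qed
  have sq: "(h T)\<^sup>2 \<le> (\<Sum>\<sigma>\<in>?L. (g \<sigma> T)\<^sup>2) / real q ^ n" for T
  proof -
    \<comment> \<open>Jensen's inequality as Cauchy-Schwarz against the constant 1.\<close>
    have "(real q ^ n * h T)\<^sup>2 \<le> (\<Sum>\<sigma>\<in>?L. (1::real)\<^sup>2) * (\<Sum>\<sigma>\<in>?L. (g \<sigma> T)\<^sup>2)"
      using Cauchy_Schwarz_ineq_sum[of "\<lambda>_. 1" "\<lambda>\<sigma>. g \<sigma> T" ?L] by (simp add: avg)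
    then have "real q ^ n * (real q ^ n * (h T)\<^sup>2) \<le> real q ^ n * (\<Sum>\<sigma>\<in>?L. (g \<sigma> T)\<^sup>2)"
      by (simp add: card_labelings power2_eq_square mult_ac)
    then show ?thesis using qn by (simp add: field_simps)
  qed
  have int: "integrable (MC n q) f" for f :: "graph \<Rightarrow> real"
    by (rule integrable_measure_pmf_finite[OF finite_set_MC[OF q]])
  have "(\<Sum>T\<in>F. (h T)\<^sup>2) \<le> (\<Sum>T\<in>F. (\<Sum>\<sigma>\<in>?L. (g \<sigma> T)\<^sup>2) / real q ^ n)"
    by (intro sum_mono sq)
  also have "\<dots> = (\<Sum>\<sigma>\<in>?L. \<Sum>T\<in>F. (g \<sigma> T)\<^sup>2) / real q ^ n"
    by (subst sum.swap) (simp add: sum_divide_distrib)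
  also have "\<dots> = measure_pmf.expectation (MC n q) (\<lambda>Y. (multilinear_form n d c Y)\<^sup>2)"
    using q by (simp add: expectation_MC second_moment_given_labels g_def F_def)
  finally have "(\<Sum>T\<in>F. (h T)\<^sup>2) \<le> measure_pmf.expectation (MC n q) (\<lambda>Y. (multilinear_form n d c Y)\<^sup>2)" .
  moreover have "measure_pmf.expectation (MC n q) (multilinear_form n d c) = h {}"
    using q by (simp add: expectation_multilinear_form h_def F_def)
  moreover have "(\<Sum>T\<in>F. (h T)\<^sup>2) = (h {})\<^sup>2 + (\<Sum>T\<in>F - {{}}. (h T)\<^sup>2)"
    using F by (rule sum.remove)
  ultimately have "(\<Sum>T\<in>F - {{}}. (h T)\<^sup>2) \<le> measure_pmf.variance (MC n q) (multilinear_form n d c)"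
    by (subst measure_pmf.variance_eq) (auto intro: int)
  moreover have "F - {{}} = {T. T \<subseteq> edges n \<and> card T \<le> d \<and> T \<noteq> {}}" by (auto simp: F_def)
  ultimately show ?thesis by (simp add: h_def F_def)
qed

text \<open>The dual weights express the mean under \<open>q\<close> through the quantities
  \<open>h T\<close> that bound the variance under \<open>q'\<close> from below. The term
  \<open>T = {}\<close> is the mean under \<open>q'\<close> and cancels; Cauchy-Schwarz handles the
  rest.\<close>

lemma mean_gap_squared_le:
  assumes q: "1 \<le> q" "1 \<le> q'"
    and nz: "\<And>S. S \<subseteq> edges n \<Longrightarrow> card S \<le> d \<Longrightarrow> cross_freq n q' S S \<noteq> 0"
  shows "(measure_pmf.expectation (MC n q) (multilinear_form n d c)
          - measure_pmf.expectation (MC n q') (multilinear_form n d c))\<^sup>2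
    \<le> (\<Sum>T | T \<subseteq> edges n \<and> card T \<le> d \<and> T \<noteq> {}. (dual_weight n q q' T)\<^sup>2)
        * measure_pmf.variance (MC n q') (multilinear_form n d c)"
proof -
  define F where "F = {S. S \<subseteq> edges n \<and> card S \<le> d}"
  define F' where "F' = {S. S \<subseteq> edges n \<and> card S \<le> d \<and> S \<noteq> {}}"
  have F: "finite F" "F = insert {} F'" "{} \<notin> F'" by (auto simp: F_def F'_def)
  then have F': "finite F'" by simp
  let ?w = "dual_weight n q q'"
  define h where "h T = (\<Sum>S\<in>F. c S * cross_freq n q' S T)" for T
  \<comment> \<open>Entries with \<open>T\<close> not contained in \<open>S\<close> vanish, so the
    recursion over subsets of \<open>S\<close> extends to all of \<open>F\<close>.\<close>
  have row: "(\<Sum>T\<in>F. ?w T * cross_freq n q' S T) = cross_freq n q S {}" if S: "S \<in> F" for S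
  proof -
    have fS: "finite S" using S finite_subset[of S "edges n"] by (simp add: F_def)
    have "Pow S \<subseteq> F"
    proof
      fix T assume "T \<in> Pow S"
      then show "T \<in> F" using S card_mono[OF fS, of T] by (auto simp: F_def)
    qed
    moreover have "cross_freq n q' S T = 0" if "T \<in> F - Pow S" for T
    proof -
      have "{\<sigma> \<in> labelings n q'. S \<inter> crossing \<sigma> = T} = {}" using that by blast
      then show ?thesis by (simp add: cross_freq_def)
    qed
    ultimately have "(\<Sum>T\<in>F. ?w T * cross_freq n q' S T) = (\<Sum>T\<in>Pow S. ?w T * cross_freq n q' S T)"
      using F by (intro sum.mono_neutral_right) auto
    then show ?thesis using dual_weight_sum[OF fS] nz S by (simp add: F_def)
  qed
  have "measure_pmf.expectation (MC n q) (multilinear_form n d c)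
      = (\<Sum>S\<in>F. c S * (\<Sum>T\<in>F. ?w T * cross_freq n q' S T))"
    using q by (simp add: expectation_multilinear_form F_def[symmetric] row)
  also have "\<dots> = (\<Sum>T\<in>F. ?w T * h T)"
    unfolding h_def sum_distrib_left by (subst sum.swap) (simp add: mult_ac)
  also have "\<dots> = h {} + (\<Sum>T\<in>F'. ?w T * h T)"
    using F F' q by (simp add: dual_weight_empty)
  finally have "measure_pmf.expectation (MC n q) (multilinear_form n d c)
      - measure_pmf.expectation (MC n q') (multilinear_form n d c) = (\<Sum>T\<in>F'. ?w T * h T)"
    using q by (simp add: expectation_multilinear_form h_def F_def)
  moreover have "(\<Sum>T\<in>F'. ?w T * h T)\<^sup>2 \<le> (\<Sum>T\<in>F'. (?w T)\<^sup>2) * (\<Sum>T\<in>F'. (h T)\<^sup>2)"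
    by (rule Cauchy_Schwarz_ineq_sum)
  moreover have "\<dots> \<le> (\<Sum>T\<in>F'. (?w T)\<^sup>2) * measure_pmf.variance (MC n q') (multilinear_form n d c)"
    using variance_multilinear_form_ge[OF q(2), where n = n and d = d and c = c]
    by (intro mult_left_mono sum_nonneg) (auto simp: F'_def h_def F_def)
  ultimately show ?thesis by (simp add: F'_def)
qed

text \<open>On values 1 and -1 only the parity of an exponent matters, so monomials are collected by
  their set of odd variables.\<close>

lemma poly_eval_multilinear_form:
  assumes "poly_vars p \<subseteq> edges n" "total_degree p \<le> d"
  obtains c where "\<And>Y. (\<And>e. e \<in> edges n \<Longrightarrow> Y e \<in> {1, -1}) \<Longrightarrow> poly_eval p Y = multilinear_form n d c Y"
proof -
  let ?K = "Poly_Mapping.keys p"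
  define odds where "odds m = {v \<in> Poly_Mapping.keys m. odd (Poly_Mapping.lookup m v)}" for m :: "(nat \<times> nat) \<Rightarrow>\<^sub>0 nat"
  define F where "F = {S. S \<subseteq> edges n \<and> card S \<le> d}"
  define c where "c S = (\<Sum>m | m \<in> ?K \<and> odds m = S. Poly_Mapping.lookup p m)" for S
  have "finite F" by (simp add: F_def)
  have odds_F: "odds m \<in> F" if m: "m \<in> ?K" for m
  proof -
    have sub: "odds m \<subseteq> edges n" using m assms(1) by (auto simp: odds_def poly_vars_def)
    \<comment> \<open>Each odd exponent is at least 1, so this reduction does not raise the
      degree.\<close>
    have "card (odds m) \<le> (\<Sum>v\<in>odds m. Poly_Mapping.lookup m v)"
      using sum_mono[of "odds m" "\<lambda>_. 1" "Poly_Mapping.lookup m"]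
      by (force simp: odds_def Suc_le_eq intro!: Nat.gr0I)
    also have "\<dots> \<le> monomial_degree m"
      unfolding monomial_degree_def by (rule sum_mono2) (auto simp: odds_def)
    also have "\<dots> \<le> total_degree p"
      unfolding total_degree_def using m by (intro Max_ge) auto
    finally show ?thesis using sub assms(2) by (simp add: F_def)
  qed
  show ?thesis
  proof (rule that)
    fix Y :: graph assume Y: "\<And>e. e \<in> edges n \<Longrightarrow> Y e \<in> {1, -1}"
    have mono: "(\<Prod>v\<in>Poly_Mapping.keys m. Y v ^ Poly_Mapping.lookup m v) = (\<Prod>v\<in>odds m. Y v)" if m: "m \<in> ?K" for m
    proof -
      have "(\<Prod>v\<in>Poly_Mapping.keys m. Y v ^ Poly_Mapping.lookup m v)
          = (\<Prod>v\<in>Poly_Mapping.keys m. if odd (Poly_Mapping.lookup m v) then Y v else 1)"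
      proof (rule prod.cong[OF refl])
        fix v assume "v \<in> Poly_Mapping.keys m"
        then have "v \<in> edges n" using m assms(1) by (auto simp: poly_vars_def)
        then have "Y v \<in> {1, -1}" by (rule Y)
        then show "Y v ^ Poly_Mapping.lookup m v = (if odd (Poly_Mapping.lookup m v) then Y v else 1)"
          by auto
      qed
      then show ?thesis by (simp add: prod.If_cases odds_def Int_def)
    qed
    have "poly_eval p Y = (\<Sum>m\<in>?K. Poly_Mapping.lookup p m * (\<Prod>v\<in>odds m. Y v))"
      unfolding poly_eval_def by (intro sum.cong) (auto simp: mono)
    also have "\<dots> = (\<Sum>S\<in>F. \<Sum>m | m \<in> ?K \<and> odds m = S. Poly_Mapping.lookup p m * (\<Prod>v\<in>odds m. Y v))"
      using odds_F by (intro sum.group[symmetric]) (auto simp: \<open>finite F\<close>)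
    also have "\<dots> = (\<Sum>S\<in>F. c S * (\<Prod>v\<in>S. Y v))"
      unfolding c_def sum_distrib_right by (intro sum.cong) auto
    finally show "poly_eval p Y = multilinear_form n d c Y"
      by (simp add: multilinear_form_def F_def)
  qed
qed


section \<open>Summing over graphs and asymptotics\<close>

text \<open>Graphs are grouped by vertex set \<open>W\<close>. Each block is at most
  \<open>K ^ card W\<close>, and the binomial theorem sums the blocks.\<close>

lemma sum_graphs_le:
  fixes \<rho> :: real and N n s :: nat
  assumes N: "1 \<le> N" "N \<le> s\<^sup>2" and \<rho>: "0 \<le> \<rho>"
  shows "(\<Sum>T | T \<subseteq> edges n \<and> card T \<le> N \<and> T \<noteq> {}. ((8 * real N) ^ card T * \<rho> ^ card (verts T))\<^sup>2)
    \<le> exp (real n * (exp 1 * (256 * real N ^ 4) ^ s * \<rho>\<^sup>2)) - 1"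
proof -
  define \<beta> where "\<beta> = 256 * real N ^ 4"
  \<comment> \<open>Part of \<open>\<beta>\<close> is set aside as a weight \<open>x\<close> per
    edge. It is so small that all graphs on \<open>v \<le> 2 * N\<close> vertices together weigh at
    most \<open>exp 1 ^ v\<close>, which replaces a count of graphs.\<close>
  define x where "x = 1 / (4 * (real N)\<^sup>2)"
  define K where "K = exp 1 * \<beta> ^ s * \<rho>\<^sup>2"
  define G where "G = {T. T \<subseteq> edges n \<and> card T \<le> N \<and> T \<noteq> {}}"
  let ?t = "\<lambda>T. ((8 * real N) ^ card T * \<rho> ^ card (verts T))\<^sup>2"
  have \<beta>: "1 \<le> \<beta>"
    using N one_le_power[of "real N" 4] unfolding \<beta>_def by linarith
  have x: "0 \<le> x" "(8 * real N)\<^sup>2 = \<beta> * x"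
    using N by (simp_all add: x_def \<beta>_def field_simps eval_nat_numeral)
  have K: "0 \<le> K" using \<beta> by (simp add: K_def)
  have block: "(\<Sum>T | T \<in> G \<and> verts T = W. ?t T) \<le> K ^ card W" if W: "W \<subseteq> {1..n}" for W
  proof (cases "{T \<in> G. verts T = W} = {}")
    case True
    then show ?thesis using K by (simp only: sum.empty) simp
  next
    case False
    define v where "v = card W"
    have fW: "finite W" using W finite_subset by blast
    have GT: "T \<in> Pow (W \<times> W)" "card T \<le> v * s" "finite T" "v \<le> 2 * N"
      if "T \<in> G" "verts T = W" for T
    proof -
      show sub: "T \<in> Pow (W \<times> W)" using that(2) by (auto intro: vertsI)
      show fT: "finite T" using that(1) finite_subset[of T "edges n"] by (simp add: G_def)
      have "card T \<le> v * v"
        using card_mono[of "W \<times> W" T] sub fW by (simp add: v_def card_cartesian_product)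
      moreover have TN: "card T \<le> N" using that(1) by (simp add: G_def)
      \<comment> \<open>One factor is bounded by \<open>N\<close>, the other by the number of vertex
        pairs; this yields at most \<open>s\<close> edges per vertex.\<close>
      ultimately have "card T * card T \<le> s\<^sup>2 * (v * v)"
        using N by (intro mult_mono) auto
      then have "(card T)\<^sup>2 \<le> (v * s)\<^sup>2" by (simp add: power2_eq_square mult_ac)
      then show "card T \<le> v * s" by (simp add: power2_nat_le_eq_le)
      show "v \<le> 2 * N" using card_verts_le[OF fT] TN that(2) by (simp add: v_def)
    qed
    have v2N: "v \<le> 2 * N" using False GT by blast
    have "(\<Sum>T | T \<in> G \<and> verts T = W. ?t T) \<le> (\<Sum>T | T \<in> G \<and> verts T = W. \<beta> ^ (v * s) * (\<rho>\<^sup>2) ^ v * x ^ card T)"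
    proof (rule sum_mono)
      fix T assume T: "T \<in> {T. T \<in> G \<and> verts T = W}"
      have "?t T = ((8 * real N)\<^sup>2) ^ card T * (\<rho>\<^sup>2) ^ v"
        using T by (simp only: v_def mem_Collect_eq power_mult_distrib power_mult[symmetric] mult.commute[of _ "2::nat"])
      also have "\<dots> = \<beta> ^ card T * ((\<rho>\<^sup>2) ^ v * x ^ card T)"
        unfolding x(2) by (simp add: power_mult_distrib)
      also have "\<dots> \<le> \<beta> ^ (v * s) * ((\<rho>\<^sup>2) ^ v * x ^ card T)"
        using T GT \<beta> x by (intro mult_right_mono power_increasing) auto
      finally show "?t T \<le> \<beta> ^ (v * s) * (\<rho>\<^sup>2) ^ v * x ^ card T" by (simp add: mult.assoc)
    qed
    also have "\<dots> \<le> (\<Sum>T\<in>Pow (W \<times> W). \<beta> ^ (v * s) * (\<rho>\<^sup>2) ^ v * x ^ card T)"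
      using fW GT \<beta> x by (intro sum_mono2) auto
    also have "\<dots> = \<beta> ^ (v * s) * (\<rho>\<^sup>2) ^ v * (1 + x) ^ (v * v)"
      using fW by (simp add: sum_distrib_left[symmetric] sum_Pow_power card_cartesian_product v_def)
    also have "\<dots> \<le> \<beta> ^ (v * s) * (\<rho>\<^sup>2) ^ v * exp 1 ^ v"
    proof (rule mult_left_mono)
      have "(1 + x) ^ (v * v) \<le> exp x ^ (v * v)"
        using x by (intro power_mono[OF exp_ge_add_one_self]) simp
      also have "\<dots> = exp (real (v * v) * x)" by (rule exp_of_nat_mult[symmetric])
      also have "\<dots> \<le> exp (real v * 1)"
      proof -
        have "2 * N * 1 \<le> 4 * N * N" using N by (intro mult_le_mono) auto
        then have "v \<le> 4 * N * N" using v2N by linarith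
        then have "real v \<le> 4 * (real N)\<^sup>2"
          unfolding power2_eq_square by (metis of_nat_le_iff of_nat_mult of_nat_numeral mult.assoc)
        then have "real v * x \<le> 1" using N by (simp add: x_def)
        then have "real v * (real v * x) \<le> real v * 1" by (intro mult_left_mono) auto
        then show ?thesis by (simp add: mult.assoc)
      qed
      also have "\<dots> = exp 1 ^ v" by (rule exp_of_nat_mult)
      finally show "(1 + x) ^ (v * v) \<le> exp 1 ^ v" .
    qed (use \<beta> in simp)
    also have "\<dots> = K ^ v"
      by (simp add: K_def power_mult_distrib power_mult[symmetric] mult_ac)
    finally show ?thesis by (simp add: v_def)
  qed
  \<comment> \<open>A nonempty \<open>T\<close> has a nonempty vertex set; the omitted
    \<open>W = {}\<close> accounts for the final \<open>- 1\<close>.\<close>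
  have "(\<Sum>T\<in>G. ?t T) = (\<Sum>W\<in>Pow {1..n} - {{}}. \<Sum>T | T \<in> G \<and> verts T = W. ?t T)"
    by (rule sum.group[symmetric]) (use verts_edges in \<open>auto simp: G_def\<close>)
  also have "\<dots> \<le> (\<Sum>W\<in>Pow {1..n} - {{}}. K ^ card W)"
    using block by (intro sum_mono) blast
  also have "\<dots> = (\<Sum>W\<in>Pow {1..n}. K ^ card W) - 1"
    by (subst (2) sum.remove[of _ "{}"]) auto
  also have "\<dots> = (1 + K) ^ n - 1" by (simp add: sum_Pow_power)
  also have "(1 + K) ^ n \<le> exp K ^ n"
    using K by (intro power_mono[OF exp_ge_add_one_self]) simp
  also have "exp K ^ n = exp (real n * K)" by (rule exp_of_nat_mult[symmetric])
  finally show ?thesis by (simp add: G_def K_def \<beta>_def)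
qed

section \<open>Combination of the estimates and the limit\<close>

lemma set_MC:
  assumes "Y \<in> set_pmf (MC n q)" "e \<in> edges n"
  shows "Y e \<in> {1, -1}"
  using assms(1) set_MC_given_labels[OF _ assms(2)] unfolding MC_def set_bind_pmf by blast

text \<open>On the support of the model, polynomial and multilinear form agree, so they share means
  and variances. Duality, the weight bound and the graph sum then combine.\<close>

lemma poly_mean_gap_squared_le:
  fixes \<rho> :: real and N n q l s :: nat
  assumes q: "1 \<le> q" "2 * N \<le> q" and l: "1 \<le> l" and N: "1 \<le> N" "N \<le> s\<^sup>2"
    and \<rho>: "0 < \<rho>" "real l / real q ^ 2 \<le> \<rho> ^ 2"
    and p: "poly_vars p \<subseteq> edges n" "total_degree p \<le> N"
  shows "(measure_pmf.expectation (MC n q) (poly_eval p)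
          - measure_pmf.expectation (MC n (q + l)) (poly_eval p))\<^sup>2
    \<le> (exp (real n * (exp 1 * (256 * real N ^ 4) ^ s * \<rho>\<^sup>2)) - 1)
        * measure_pmf.variance (MC n (q + l)) (poly_eval p)"
proof -
  obtain c where c: "\<And>Y. (\<And>e. e \<in> edges n \<Longrightarrow> Y e \<in> {1, -1}) \<Longrightarrow>
      poly_eval p Y = multilinear_form n N c Y"
    using poly_eval_multilinear_form[OF p] by metis
  have eq: "poly_eval p Y = multilinear_form n N c Y" if "Y \<in> set_pmf (MC n k)" for Y k
    using set_MC[OF that] by (intro c)
  have E: "measure_pmf.expectation (MC n k) (poly_eval p)
      = measure_pmf.expectation (MC n k) (multilinear_form n N c)" for k
    using eq by (intro integral_cong_AE) (auto simp: AE_measure_pmf_iff)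
  have V: "measure_pmf.variance (MC n k) (poly_eval p)
      = measure_pmf.variance (MC n k) (multilinear_form n N c)" for k
    unfolding E using eq by (intro integral_cong_AE) (auto simp: AE_measure_pmf_iff)
  have q': "1 \<le> q + l" using q by simp
  have nz: "cross_freq n (q + l) S S \<noteq> 0" if "S \<subseteq> edges n" "card S \<le> N" for S
  proof -
    have "real (card S) / real (q + l) < 1" using that q l by (simp add: field_simps)
    then show ?thesis using cross_freq_self_ge[OF that(1) q'] by linarith
  qed
  have "(\<Sum>T | T \<subseteq> edges n \<and> card T \<le> N \<and> T \<noteq> {}. (dual_weight n q (q + l) T)\<^sup>2)
      \<le> (\<Sum>T | T \<subseteq> edges n \<and> card T \<le> N \<and> T \<noteq> {}. ((8 * real N) ^ card T * \<rho> ^ card (verts T))\<^sup>2)"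
  proof (rule sum_mono)
    fix T assume "T \<in> {T. T \<subseteq> edges n \<and> card T \<le> N \<and> T \<noteq> {}}"
    then have "\<bar>dual_weight n q (q + l) T\<bar> \<le> (8 * real N) ^ card T * \<rho> ^ card (verts T)"
      using q l \<rho> by (intro dual_weight_bound) auto
    from power_mono[OF this, of 2]
    show "(dual_weight n q (q + l) T)\<^sup>2 \<le> ((8 * real N) ^ card T * \<rho> ^ card (verts T))\<^sup>2" by simp
  qed
  also have "\<dots> \<le> exp (real n * (exp 1 * (256 * real N ^ 4) ^ s * \<rho>\<^sup>2)) - 1"
    using N \<rho> by (intro sum_graphs_le) auto
  finally have "(\<Sum>T | T \<subseteq> edges n \<and> card T \<le> N \<and> T \<noteq> {}. (dual_weight n q (q + l) T)\<^sup>2)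
      * measure_pmf.variance (MC n (q + l)) (multilinear_form n N c)
    \<le> (exp (real n * (exp 1 * (256 * real N ^ 4) ^ s * \<rho>\<^sup>2)) - 1)
      * measure_pmf.variance (MC n (q + l)) (multilinear_form n N c)"
    by (intro mult_right_mono measure_pmf.variance_positive)
  moreover have "(measure_pmf.expectation (MC n q) (multilinear_form n N c)
        - measure_pmf.expectation (MC n (q + l)) (multilinear_form n N c))\<^sup>2
      \<le> (\<Sum>T | T \<subseteq> edges n \<and> card T \<le> N \<and> T \<noteq> {}. (dual_weight n q (q + l) T)\<^sup>2)
        * measure_pmf.variance (MC n (q + l)) (multilinear_form n N c)"
    by (rule mean_gap_squared_le[OF q(1) q' nz])
  ultimately show ?thesis unfolding V unfolding E by linarith
qed

text \<open>The degree hypothesis enters here: about \<open>sqrt (D n)\<close> factors, each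
  polynomial in \<open>D n\<close>, cost less than \<open>n powr \<epsilon>\<close>. The shift to
  \<open>D n + 1\<close> provides a degree bound of at least 1.\<close>

lemma graph_sum_exponent_tendsto_0:
  fixes D :: "nat \<Rightarrow> nat" and \<epsilon> :: real
  assumes \<epsilon>: "\<epsilon> > 0"
    and D: "(\<lambda>n. real (D n)) \<in> o[sequentially](\<lambda>n. (ln (real n) / ln (ln (real n))) ^ 2)"
  shows "(\<lambda>n. real n * (exp 1 * (256 * real (D n + 1) ^ 4) ^ nat \<lceil>sqrt (real (D n + 1))\<rceil>
            * real n powr - (1 + \<epsilon>))) \<longlonglongrightarrow> 0"
    and "\<forall>\<^sub>F n in sequentially. 2 * real (D n + 1) \<le> sqrt (real n)"
proof -
  define g where "g n = ln (real n) / ln (ln (real n))" for n :: nat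
  \<comment> \<open>The logarithm of the base is about \<open>8 * ln (ln n)\<close>, so the cost is
    about \<open>8 * \<delta> * ln n\<close>, well below \<open>\<epsilon> * ln n\<close>.\<close>
  define \<delta> where "\<delta> = \<epsilon> / 20"
  have \<delta>: "\<delta> > 0" using \<epsilon> by (simp add: \<delta>_def)
  have "\<forall>\<^sub>F n in sequentially. norm (real (D n)) \<le> \<delta>\<^sup>2 * norm ((g n)\<^sup>2)"
    using landau_o.smallD[OF D, of "\<delta>\<^sup>2"] \<delta> by (simp add: g_def)
  then have DB: "\<forall>\<^sub>F n in sequentially. real (D n) \<le> (\<delta> * g n)\<^sup>2"
    by eventually_elim (simp add: power_mult_distrib)
  have gpos: "\<forall>\<^sub>F n in sequentially. 0 \<le> g n" unfolding g_def by real_asymp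
  have n0: "\<forall>\<^sub>F n in sequentially. 1 \<le> n" by (rule eventually_ge_at_top)
  have "\<forall>\<^sub>F n in sequentially. 2 * ((\<delta> * g n)\<^sup>2 + 1) \<le> sqrt (real n)"
    unfolding g_def \<delta>_def using \<epsilon> by real_asymp
  with DB show "\<forall>\<^sub>F n in sequentially. 2 * real (D n + 1) \<le> sqrt (real n)"
    by eventually_elim simp
  let ?h = "\<lambda>n. real n * (exp 1 * (256 * real (D n + 1) ^ 4) ^ nat \<lceil>sqrt (real (D n + 1))\<rceil>
            * real n powr - (1 + \<epsilon>))"
  let ?b = "\<lambda>n. exp (1 + (\<delta> * g n + 2) * ln (256 * ((\<delta> * g n)\<^sup>2 + 1) ^ 4) - \<epsilon> * ln (real n))"
  have lim: "?b \<longlonglongrightarrow> 0"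
    unfolding g_def \<delta>_def using \<epsilon> by real_asymp
  have bound: "\<forall>\<^sub>F n in sequentially. ?h n \<le> ?b n"
    using DB gpos n0
  proof eventually_elim
    case (elim n)
    define N where "N = real (D n + 1)"
    define s where "s = nat \<lceil>sqrt N\<rceil>"
    define L where "L = ln (256 * N ^ 4)"
    have N: "1 \<le> N" "N \<le> (\<delta> * g n)\<^sup>2 + 1" using elim by (auto simp: N_def)
    have N4: "1 \<le> 256 * N ^ 4" using N one_le_power[of N 4] by linarith
    have dg: "0 \<le> \<delta> * g n" using elim \<delta> by simp
    have "sqrt N \<le> \<delta> * g n + 1"
    proof (rule real_le_lsqrt)
      show "N \<le> (\<delta> * g n + 1)\<^sup>2" using N dg by (simp add: power2_eq_square algebra_simps)
    qed (use N dg in auto)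
    moreover have "real s \<le> sqrt N + 1"
      unfolding s_def using N real_sqrt_ge_zero[of N] by (simp add: le_ceiling_iff)
    ultimately have s: "real s \<le> \<delta> * g n + 2" by linarith
    have L: "0 \<le> L" "L \<le> ln (256 * ((\<delta> * g n)\<^sup>2 + 1) ^ 4)"
      unfolding L_def using N N4 by (auto intro!: ln_mono power_mono mult_left_mono add_nonneg_pos)
    have "exp L = 256 * N ^ 4" unfolding L_def using N4 by (intro exp_ln) linarith
    then have pw: "(256 * N ^ 4) ^ s = exp (real s * L)" by (simp only: exp_of_nat_mult)
    have "?h n = real n * (exp 1 * exp (real s * L) * real n powr - (1 + \<epsilon>))"
      by (simp only: N_def[symmetric] s_def[symmetric] pw)
    also have "\<dots> = exp (1 + real s * L) * (real n powr 1 * real n powr - (1 + \<epsilon>))"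
      using elim by (simp add: exp_add)
    also have "real n powr 1 * real n powr - (1 + \<epsilon>) = real n powr - \<epsilon>"
      by (simp only: powr_add[symmetric]) simp
    also have "\<dots> = exp (- \<epsilon> * ln (real n))" using elim by (simp add: powr_def)
    also have "exp (1 + real s * L) * \<dots> = exp (1 + real s * L - \<epsilon> * ln (real n))"
      by (simp add: exp_add[symmetric])
    also have "\<dots> \<le> ?b n"
      using s L dg by (simp add: mult_mono)
    finally show ?case .
  qed
  show "?h \<longlonglongrightarrow> 0"
    by (rule tendsto_sandwich[OF _ bound tendsto_const lim]) simp
qed

theorem theorem2p10:
  fixes \<epsilon> :: real and q l D :: "nat \<Rightarrow> nat"
  assumes "\<epsilon> > 0"
    and "\<forall>\<^sub>F n in sequentially.
           1 \<le> q n \<and> q n < q n + l n \<and> q n + l n \<le> n \<and>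
           real (q n) ^ 2 \<ge> real (l n) * real n powr (1 + \<epsilon>)"
    and "(\<lambda>n. real (D n)) \<in> o[sequentially](\<lambda>n. (ln (real n) / ln (ln (real n))) ^ 2)"
  shows "\<not> (\<exists>p :: nat \<Rightarrow> (nat \<times> nat) real_poly.
              (\<forall>n. poly_vars (p n) \<subseteq> edges n \<and> total_degree (p n) \<le> D n) \<and>
              weakly_separates (\<lambda>n. poly_eval (p n))
                (\<lambda>n. MC n (q n)) (\<lambda>n. MC n (q n + l n)))"
proof
  assume "\<exists>p :: nat \<Rightarrow> (nat \<times> nat) real_poly.
              (\<forall>n. poly_vars (p n) \<subseteq> edges n \<and> total_degree (p n) \<le> D n) \<and>
              weakly_separates (\<lambda>n. poly_eval (p n))
                (\<lambda>n. MC n (q n)) (\<lambda>n. MC n (q n + l n))"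
  then obtain p :: "nat \<Rightarrow> (nat \<times> nat) real_poly"
    where p: "\<And>n. poly_vars (p n) \<subseteq> edges n" "\<And>n. total_degree (p n) \<le> D n"
      and ws: "weakly_separates (\<lambda>n. poly_eval (p n)) (\<lambda>n. MC n (q n)) (\<lambda>n. MC n (q n + l n))"
    by blast
  define gap where "gap n = measure_pmf.expectation (MC n (q n)) (poly_eval (p n))
      - measure_pmf.expectation (MC n (q n + l n)) (poly_eval (p n))" for n
  define Var where "Var n = measure_pmf.variance (MC n (q n + l n)) (poly_eval (p n))" for n
  define h where "h n = real n * (exp 1 * (256 * real (D n + 1) ^ 4) ^ nat \<lceil>sqrt (real (D n + 1))\<rceil>
            * real n powr - (1 + \<epsilon>))" for n
  have gap0: "\<forall>\<^sub>F n in sequentially. gap n \<noteq> 0"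
    using ws unfolding weakly_separates_def gap_def by simp
  obtain C where C: "C > 0"
    "\<forall>\<^sub>F n in sequentially. norm (sqrt (max (Var n)
        (measure_pmf.variance (MC n (q n)) (poly_eval (p n))))) \<le> C * norm \<bar>gap n\<bar>"
    using ws unfolding weakly_separates_def gap_def Var_def by (auto elim!: landau_o.bigE)
  have "(\<lambda>n. exp (h n) - 1) \<longlonglongrightarrow> exp 0 - 1"
    unfolding h_def
    by (intro tendsto_intros graph_sum_exponent_tendsto_0(1) assms)
  \<comment> \<open>Separation gives \<open>Var n \<le> C\<^sup>2 * (gap n)\<^sup>2\<close>, so a
    factor below \<open>1 / C\<^sup>2\<close> contradicts the gap bound.\<close>
  then have "\<forall>\<^sub>F n in sequentially. exp (h n) - 1 < 1 / C\<^sup>2"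
    using C(1) by (intro order_tendstoD(2)) auto
  then have "\<forall>\<^sub>F n :: nat in sequentially. False"
    using gap0 C(2) assms(2) graph_sum_exponent_tendsto_0(2)[OF assms(1,3)]
      eventually_ge_at_top[of 1]
  proof eventually_elim
    case (elim n)
    define N where "N = D n + 1"
    \<comment> \<open>The square of this \<open>\<rho>\<close> is
      \<open>n powr - (1 + \<epsilon>)\<close>, so the hypothesis on \<open>q\<close> becomes
      \<open>lq\<close>.\<close>
    define \<rho> where "\<rho> = real n powr (- (1 + \<epsilon>) / 2)"
    have n: "1 \<le> n" and l: "1 \<le> l n" and q1: "1 \<le> q n" using elim by auto
    have \<rho>: "0 < \<rho>" using n by (simp add: \<rho>_def)
    have \<rho>2: "\<rho>\<^sup>2 = real n powr - (1 + \<epsilon>)"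
      by (simp add: \<rho>_def power2_eq_square powr_add[symmetric])
    have np: "0 < real n powr (1 + \<epsilon>)" using n by simp
    have q2: "real (l n) * real n powr (1 + \<epsilon>) \<le> (real (q n))\<^sup>2" using elim by simp
    have lq: "real (l n) / (real (q n))\<^sup>2 \<le> \<rho>\<^sup>2"
    proof -
      have "real (l n) \<le> (real (q n))\<^sup>2 / real n powr (1 + \<epsilon>)" using q2 np by (simp add: field_simps)
      then have "real (l n) \<le> \<rho>\<^sup>2 * (real (q n))\<^sup>2" unfolding \<rho>2 powr_minus by (simp add: field_simps)
      then show ?thesis using q1 by (simp add: divide_le_eq)
    qed
    \<comment> \<open>As \<open>l n\<close> is at least 1, \<open>q n\<close> is at least
      \<open>sqrt n\<close>, which exceeds twice the degree bound.\<close>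
    have "real n \<le> (real (q n))\<^sup>2"
    proof -
      have "1 * real n powr 1 \<le> real (l n) * real n powr (1 + \<epsilon>)"
        using l n assms(1) by (intro mult_mono powr_mono) auto
      then show ?thesis using q2 by (simp only: powr_one of_nat_0_le_iff)
    qed
    then have "sqrt (real n) \<le> real (q n)" by (simp add: real_le_lsqrt)
    then have "2 * real N \<le> real (q n)" using elim by (simp add: N_def)
    then have qN: "2 * N \<le> q n" by linarith
    have sN: "N \<le> (nat \<lceil>sqrt (real N)\<rceil>)\<^sup>2"
    proof -
      have "(sqrt (real N))\<^sup>2 \<le> (real (nat \<lceil>sqrt (real N)\<rceil>))\<^sup>2"
        by (intro power_mono real_nat_ceiling_ge) simp
      then have "real N \<le> real ((nat \<lceil>sqrt (real N)\<rceil>)\<^sup>2)" by simp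
      then show ?thesis by (simp only: of_nat_le_iff)
    qed
    have "total_degree (p n) \<le> N" using p(2)[of n] by (simp add: N_def)
    then have "(gap n)\<^sup>2 \<le> (exp (real n * (exp 1 * (256 * real N ^ 4) ^ nat \<lceil>sqrt (real N)\<rceil> * \<rho>\<^sup>2)) - 1) * Var n"
      unfolding gap_def Var_def
      by (intro poly_mean_gap_squared_le q1 qN l sN \<rho> lq p(1)) (simp_all add: N_def)
    then have gapV: "(gap n)\<^sup>2 \<le> (exp (h n) - 1) * Var n" by (simp only: h_def N_def \<rho>2)
    have V0: "0 \<le> Var n" unfolding Var_def by (rule measure_pmf.variance_positive)
    have "sqrt (Var n) \<le> C * \<bar>gap n\<bar>"
      using elim V0 by (auto intro: order.trans[OF real_sqrt_le_mono[OF max.cobounded1]])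
    then have "(sqrt (Var n))\<^sup>2 \<le> (C * \<bar>gap n\<bar>)\<^sup>2" using V0 by (intro power_mono) auto
    then have VC: "Var n \<le> C\<^sup>2 * (gap n)\<^sup>2" using V0 by (simp add: power_mult_distrib)
    have "0 < (gap n)\<^sup>2" using elim by simp
    \<comment> \<open>A vanishing variance would force a zero gap; positivity makes the next
      comparison strict.\<close>
    then have "0 < Var n" using gapV V0 by (cases "Var n = 0") auto
    then have "(exp (h n) - 1) * Var n < 1 / C\<^sup>2 * Var n"
      using elim by (intro mult_strict_right_mono) auto
    also have "\<dots> \<le> (gap n)\<^sup>2" using VC C(1) by (simp add: field_simps)
    finally show False using gapV by simp
  qed
  then show False by simp
qed

end
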